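(* Let $S\subset\mathbb{R}^d$ be a compact, nonconvex and nonempty set satisfying condition $(R_\lambda^r)$ for some $r>0$ and $\lambda>0$, that is, $S$ fulfills the $r$-rolling condition and $S^c$ fulfills the $\lambda$-rolling condition. Let $X_1,X_2,\dots$ be i.i.d. random points with the uniform distribution on $S$, and let $\mathcal{X}_n=\{X_1,\dots,X_n\}$. Let $\{\alpha_n\}\subset(0,1)$ be a sequence converging to zero such that $\lim_{n\to\infty}\log(\alpha_n)/n=0$, and let $\hat r_0=\sup\{\gamma>0:\ \hat V_{n,\gamma}\le \hat c_{n,\alpha_n,\gamma}\}$. Let $\nu\in(0,1)$ and $r_n=\nu\hat r_0$. Then $$d_H(S,C_{r_n}(\mathcal{X}_n))=O_P\left(\left(\frac{\log n}{n}\right)^{\frac{2}{d+1}}\right).$$ The same convergence order holds for $d_H(\partial S,\partial C_{r_n}(\mathcal{X}_n))$ and for $d_\mu(S,C_{r_n}(\mathcal{X}_n))=\mu(S\triangle C_{r_n}(\mathcal{X}_n))$.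
   Context: $B_r(x)$ and $B_r[x]$ denote the open and closed Euclidean balls in $\mathbb{R}^d$ with center $x$ and radius $r$; $\mu$ is Lebesgue measure on $\mathbb{R}^d$; $\triangle$ is symmetric difference. For closed, bounded, nonempty $A,C\subset\mathbb{R}^d$, the Hausdorff distance is $d_H(A,C)=\max\{\sup_{a\in A}d(a,C),\sup_{c\in C}d(c,A)\}$ with $d(a,C)=\inf\{\|a-c\|:c\in C\}$. For bounded Borel sets, $d_\mu(A,C)=\mu(A\triangle C)$. A set $A\subset\mathbb{R}^d$ fulfills the (outside) $r$-rolling condition if each boundary point $a\in\partial A$ is contained in a closed ball of radius $r$ whose interior does not meet $A$. The $r$-convex hull of $A$ is $C_r(A)=\bigcap_{\{B_r(x):\,B_r(x)\cap A=\emptyset\}}(B_r(x))^c$; a closed set $A$ is $r$-convex if $A=C_r(A)$. By convention $C_\infty(\mathcal{X}_n)$ is the convex hull of $\mathcal{X}_n$ and $C_0(\mathcal{X}_n)=\mathcal{X}_n$. Test quantities. For $\gamma>0$, let $\hat\Delta_{n,\gamma}=\sup\{\rho>0:\exists x \text{ with } B_\rho[x]\subset C_\gamma(\mathcal{X}_n)\setminus\mathcal{X}_n\}$ (with value $0$ if there is no such $\rho$), and let $\hat V_{n,\gamma}$ be the Lebesgue measure of a ball of radius $\hat\Delta_{n,\gamma}$. For $\alpha\in(0,1)$ let $u_\alpha=-\log(-\log(1-\alpha))$, the $(1-\alpha)$-quantile of a random variable $U$ with $\mathbb{P}(U\le u)=\exp(-\exp(-u))$, $u\in\mathbb{R}$.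 For $n\ge 2$ define $$\hat c_{n,\alpha,\gamma}=\frac{\mu(C_\gamma(\mathcal{X}_n))\left(u_\alpha+\log n+(d-1)\log\log n+\log\beta\right)}{n},$$ where $\beta$ is Janson's constant $\beta=\frac{1}{d!}\left(\frac{\sqrt{\pi}\,\Gamma(d/2+1)}{\Gamma((d+1)/2)}\right)^{d-1}$ (so $\beta=1$ for $d=2$). The uniformity hypothesis $H_0$ on $C_\gamma(\mathcal{X}_n)$ is rejected at level $\alpha$ if $\hat V_{n,\gamma}>\hat c_{n,\alpha,\gamma}$ and accepted otherwise. The estimator $\hat r_0$ takes values in $[0,+\infty]$ (supremum of the empty set being $0$, and the supremum of an unbounded set $+\infty$). *)

theory Defs
  imports "HOL-Probability.Probability"
begin

text \<open>The ambient space is an arbitrary type of class \<open>euclidean_space\<close>; the dimension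
  $d$ is \<open>DIM('a)\<close>.\<close>

definition rolling_condition :: "real \<Rightarrow> 'a::euclidean_space set \<Rightarrow> bool" where
  "rolling_condition r A \<longleftrightarrow>
     (\<forall>a\<in>frontier A. \<exists>x. a \<in> cball x r \<and> interior (cball x r) \<inter> A = {})"

definition rolling_R :: "real \<Rightarrow> real \<Rightarrow> 'a::euclidean_space set \<Rightarrow> bool" where
  "rolling_R l r S \<longleftrightarrow> rolling_condition r S \<and> rolling_condition l (- S)"

definition r_convex_hull :: "real \<Rightarrow> 'a::euclidean_space set \<Rightarrow> 'a set" where
  "r_convex_hull r A = (\<Inter>x\<in>{x. ball x r \<inter> A = {}}. - ball x r)"

text \<open>Radii in $[0,\infty]$: the values at $0$ and $\infty$ are conventions, not instances of the
  formula above.\<close>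

definition r_convex_hull_ext :: "ennreal \<Rightarrow> 'a::euclidean_space set \<Rightarrow> 'a set" where
  "r_convex_hull_ext r A =
     (if r = \<infinity> then convex hull A
      else if r = 0 then A
      else r_convex_hull (enn2real r) A)"

text \<open>Only meaningful for bounded nonempty sets, where the real suprema exist;
  \<open>infdist a C\<close> is $\inf\{\|a-c\| : c \in C\}$.\<close>

definition hausdorff_distance :: "'a::euclidean_space set \<Rightarrow> 'a set \<Rightarrow> real" where
  "hausdorff_distance A C = max (SUP a\<in>A. infdist a C) (SUP c\<in>C. infdist c A)"

definition measure_distance :: "'a::euclidean_space set \<Rightarrow> 'a set \<Rightarrow> real" where
  "measure_distance A C = measure lborel (sym_diff A C)"

text \<open>In the following three definitions \<open>A\<close> is the set of sample points. The inserted \<open>0\<close> gives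
  the maximal-gap radius the value $0$ when no closed ball of positive radius fits.\<close>

definition max_gap_radius :: "real \<Rightarrow> 'a::euclidean_space set \<Rightarrow> real" where
  "max_gap_radius \<gamma> A =
     Sup (insert 0 {\<rho>. 0 < \<rho> \<and> (\<exists>x. cball x \<rho> \<subseteq> r_convex_hull \<gamma> A - A)})"

definition max_gap_volume :: "real \<Rightarrow> 'a::euclidean_space set \<Rightarrow> real" where
  "max_gap_volume \<gamma> A = measure lborel (cball (0::'a) (max_gap_radius \<gamma> A))"

definition gumbel_quantile :: "real \<Rightarrow> real" where
  "gumbel_quantile \<alpha> = - ln (- ln (1 - \<alpha>))"

definition janson_beta :: "nat \<Rightarrow> real" where
  "janson_beta d =
     1 / fact d * (sqrt pi * Gamma (real d / 2 + 1) / Gamma ((real d + 1) / 2)) ^ (d - 1)"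

text \<open>The sample size \<open>n\<close> is a separate argument rather than \<open>card A\<close>. The formula is intended
  for \<open>n \<ge> 2\<close>; smaller \<open>n\<close> give junk values.\<close>

definition critical_value :: "nat \<Rightarrow> real \<Rightarrow> real \<Rightarrow> 'a::euclidean_space set \<Rightarrow> real" where
  "critical_value n \<alpha> \<gamma> A =
     measure lborel (r_convex_hull \<gamma> A) *
       (gumbel_quantile \<alpha> + ln (real n) + (real DIM('a) - 1) * ln (ln (real n))
          + ln (janson_beta DIM('a))) / real n"

text \<open>In \<^typ>\<open>ennreal\<close> the supremum of the empty set is $0$ and that of an unbounded set
  is $\infty$.\<close>

definition r0_estimator :: "nat \<Rightarrow> real \<Rightarrow> 'a::euclidean_space set \<Rightarrow> ennreal" where
  "r0_estimator n \<alpha> A =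
     (SUP \<gamma>\<in>{\<gamma>. 0 < \<gamma> \<and> max_gap_volume \<gamma> A \<le> critical_value n \<alpha> \<gamma> A}. ennreal \<gamma>)"

text \<open>Stochastic boundedness $Y_n = O_P(a_n)$, with outer probability so that a non-measurable
  exceedance set does not silently get measure $0$. For random variables \<open>Y n\<close> this is the usual
  notion.\<close>

definition bigO_P :: "'b measure \<Rightarrow> (nat \<Rightarrow> 'b \<Rightarrow> real) \<Rightarrow> (nat \<Rightarrow> real) \<Rightarrow> bool" where
  "bigO_P M Y a \<longleftrightarrow>
     (\<forall>\<epsilon>>0. \<exists>K. \<exists>N. \<forall>n\<ge>N. \<exists>E\<in>sets M.
        {\<omega>\<in>space M. K * \<bar>a n\<bar> < \<bar>Y n \<omega>\<bar>} \<subseteq> E \<and> measure M E \<le> \<epsilon>)"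

end

theory Submission
  imports Defs "HOL-Real_Asymp.Real_Asymp"
begin

text \<open>
  Let \<open>r\<^sub>0\<close> be the largest radius with \<open>C\<^bsub>\<gamma>\<^esub>(S) = S\<close> for all smaller \<open>\<gamma>\<close>; it is finite because \<open>S\<close> is
  not convex, and at least \<open>r\<close> by the rolling conditions. If every point of \<open>S\<close> at depth \<open>\<epsilon>\<close> lies in
  \<open>C\<^bsub>\<gamma>\<^esub>(A)\<close>, where \<open>A \<subseteq> S\<close> is the sample, and \<open>\<gamma> \<le> \<gamma>' < r\<^sub>0\<close>, then \<open>C\<^bsub>\<gamma>'\<^esub>(A)\<close> lies between the \<open>\<epsilon>\<close>-erosion
  of \<open>S\<close> and \<open>S\<close>, so all three distances are \<open>O(\<epsilon>)\<close>. A ball of radius \<open>\<gamma>\<close> that contains a point of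
  depth \<open>\<epsilon>\<close> meets \<open>S\<close> in volume at least of order \<open>\<epsilon>\<^bsup>(d+1)/2\<^esup>\<close>, so a union bound over a polynomial
  net of centers gives \<open>\<epsilon>\<close> of order \<open>(log n / n)\<^bsup>2/(d+1)\<^esup>\<close> for fixed \<open>\<gamma>\<close>. It thus suffices that the estimator is,
  with probability tending to one, at least \<open>min r \<lambda>\<close> and at most some \<open>m\<close> with \<open>\<nu> m < r\<^sub>0\<close>. The upper
  bound holds because \<open>C\<^bsub>m\<^esub>(A) - S\<close> contains a fixed ball once \<open>A\<close> is dense enough in \<open>S\<close>, while the
  critical value tends to zero. For the lower bound only the first-moment half of Janson's theorem is
  needed, and since \<open>\<alpha>\<^sub>n\<close> tends to zero it need only be sharp up to a constant factor: a net of mesh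
  \<open>\<rho> / log n\<close> has of order \<open>n (log n)\<^bsup>d-1\<^esup>\<close> points, which accounts for the term \<open>(d - 1) log log n\<close> exactly.
\<close>

section \<open>Balls and $r$-convex hulls\<close>

text \<open>If the centers were closer, the point dividing the segment from \<open>c\<close> to
  \<open>x\<close> in the ratio \<open>s : t\<close> would lie in both balls.\<close>

lemma ball_disjoint_dist:
  fixes c x :: "'a::euclidean_space"
  assumes "0 < s" "0 < t" "ball c s \<inter> ball x t = {}"
  shows "s + t \<le> dist c x"
proof (rule ccontr)
  assume a: "\<not> s + t \<le> dist c x"
  define p where "p = c + (s / (s + t)) *\<^sub>R (x - c)"
  have st: "s + t > 0" "norm (x - c) < s + t"
    using assms a by (auto simp: dist_norm norm_minus_commute)
  have "dist c p = s * norm (x - c) / (s + t)"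
    using assms by (simp add: p_def dist_norm)
  also have "\<dots> < s" using st mult_strict_left_mono[OF st(2) assms(1)] by (simp add: pos_divide_less_eq)
  finally have 1: "p \<in> ball c s" by simp
  have "x - p = (t / (s + t)) *\<^sub>R (x - c)"
    using st by (simp add: p_def algebra_simps add_divide_distrib[symmetric] scaleR_add_left[symmetric])
  hence "dist x p = t * norm (x - c) / (s + t)"
    using assms by (simp add: dist_norm)
  also have "\<dots> < t" using st mult_strict_left_mono[OF st(2) assms(2)] by (simp add: pos_divide_less_eq)
  finally have "p \<in> ball x t" by simp
  with 1 assms(3) show False by blast
qed

text \<open>The triangle inequality for \<open>c\<close>, \<open>a\<close>, \<open>x\<close> is an
  equality, so \<open>a\<close> lies on the segment between the centers. This identifies normal
  directions at frontier points.\<close>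

lemma touching_balls:
  fixes a c x :: "'a::euclidean_space"
  assumes "0 < s" "0 < t" "ball c s \<inter> ball x t = {}" "dist a c = s" "dist a x = t"
  shows "(x - a) /\<^sub>R t = (a - c) /\<^sub>R s"
proof -
  have "norm (x - c) = norm (x - a) + norm (a - c)"
    using ball_disjoint_dist[OF assms(1-3)] assms(4,5) dist_triangle[of c x a]
    by (simp add: dist_norm norm_minus_commute)
  hence "norm ((x - a) + (a - c)) = norm (x - a) + norm (a - c)" by simp
  hence "norm (x - a) *\<^sub>R (a - c) = norm (a - c) *\<^sub>R (x - a)"
    by (simp only: norm_triangle_eq)
  hence "t *\<^sub>R (a - c) = s *\<^sub>R (x - a)"
    using assms by (simp add: dist_norm norm_minus_commute)
  hence "(inverse s * inverse t) *\<^sub>R (t *\<^sub>R (a - c)) = (inverse s * inverse t) *\<^sub>R (s *\<^sub>R (x - a))" by simp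
  moreover have "inverse s * inverse t * t = inverse s" "inverse s * inverse t * s = inverse t"
    using assms(1,2) by simp_all
  ultimately show ?thesis by (simp only: scaleR_scaleR)
qed

lemma ball_subset_frontier:
  fixes z :: "'a::euclidean_space"
  assumes "z \<in> S" "\<not> ball z e \<subseteq> S"
  obtains a where "a \<in> frontier S" "dist z a < e"
proof -
  obtain w where w: "w \<in> ball z e" "w \<notin> S" using assms(2) by blast
  have "ball z e \<inter> frontier S \<noteq> {}"
  proof (rule connected_Int_frontier)
    have "z \<in> ball z e" using le_less_trans[OF zero_le_dist, of z w e] w by simp
    thus "ball z e \<inter> S \<noteq> {}" using assms(1) by blast
  qed (use w in auto)
  thus ?thesis using that by auto
qed

lemma r_convex_hull_superset: "A \<subseteq> r_convex_hull g A"
  by (auto simp: r_convex_hull_def)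

lemma r_convex_hull_mono: "A \<subseteq> B \<Longrightarrow> r_convex_hull g A \<subseteq> r_convex_hull g B"
  by (auto simp: r_convex_hull_def)

lemma closed_r_convex_hull: "closed (r_convex_hull g A)"
  unfolding r_convex_hull_def by (intro closed_INT ballI) (simp add: closed_Compl)

text \<open>The homothety with center \<open>z\<close> and ratio \<open>g / g'\<close> maps the
  larger ball into itself, onto a ball of radius \<open>g\<close> that still contains
  \<open>z\<close>.\<close>

lemma smaller_ball_through_point:
  fixes y z :: "'a::euclidean_space"
  assumes "0 < g" "g \<le> g'" "z \<in> ball y g'"
  obtains y' where "z \<in> ball y' g" "ball y' g \<subseteq> ball y g'"
proof -
  define y' where "y' = z + (g / g') *\<^sub>R (y - z)"
  have n: "norm (y - z) < g'" "g' > 0" using assms by (auto simp: dist_norm)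
  have "dist y' z = g * norm (y - z) / g'"
    using assms n by (simp add: y'_def dist_norm)
  also have "\<dots> < g" using assms n by (simp add: field_simps)
  finally have 1: "z \<in> ball y' g" by simp
  have "y - y' = (1 - g / g') *\<^sub>R (y - z)" by (simp add: y'_def algebra_simps)
  hence "dist y y' = (1 - g / g') * norm (y - z)"
    using assms n by (simp add: dist_norm)
  also have "\<dots> \<le> (1 - g / g') * g'" using assms n by (intro mult_left_mono) auto
  also have "\<dots> = g' - g" using n by (simp add: field_simps)
  finally have "ball y' g \<subseteq> ball y g'"
    by (simp add: ball_subset_ball_iff dist_commute)
  thus ?thesis using 1 that by blast
qed

text \<open>An empty ball of radius \<open>g'\<close> that removes a point contains an empty ball of
  radius \<open>g\<close> that removes the same point.\<close>

lemma r_convex_hull_mono_radius: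
  assumes "0 < g" "g \<le> g'"
  shows "r_convex_hull g A \<subseteq> r_convex_hull g' A"
proof
  fix z assume z: "z \<in> r_convex_hull g A"
  show "z \<in> r_convex_hull g' A"
  proof (rule ccontr)
    assume "z \<notin> r_convex_hull g' A"
    then obtain y where y: "ball y g' \<inter> A = {}" "z \<in> ball y g'"
      unfolding r_convex_hull_def by blast
    obtain y' where "z \<in> ball y' g" "ball y' g \<subseteq> ball y g'"
      using smaller_ball_through_point[OF assms y(2)] .
    with y z show False by (fastforce simp: r_convex_hull_def)
  qed
qed

text \<open>A hyperplane separates an outside point from the convex hull, and on the far side of it
  there is room for a ball of radius \<open>g\<close> that contains the point and misses
  \<open>A\<close>.\<close>

lemma r_convex_hull_subset_convex_hull:
  fixes A :: "'a::euclidean_space set"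
  assumes "compact A" "A \<noteq> {}" "0 < g"
  shows "r_convex_hull g A \<subseteq> convex hull A"
proof
  fix z assume z: "z \<in> r_convex_hull g A"
  show "z \<in> convex hull A"
  proof (rule ccontr)
    assume nz: "z \<notin> convex hull A"
    obtain v b where vb: "v \<bullet> z < b" "\<forall>x\<in>convex hull A. v \<bullet> x > b"
      using separating_hyperplane_closed_point[OF convex_convex_hull _ nz]
        compact_imp_closed[OF compact_convex_hull[OF assms(1)]] by blast
    have v0: "v \<noteq> 0" using vb assms(2) hull_subset[of A convex] by fastforce
    \<comment> \<open>The ball about \<open>y\<close> touches the separating hyperplane from the
      side of \<open>z\<close>. It contains \<open>z\<close> if \<open>z\<close> is closer than
      \<open>2 * g\<close> to the hyperplane; otherwise the ball about \<open>z\<close> itself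
      serves.\<close>
    define y where "y = z - (g - (b - v \<bullet> z) / norm v) *\<^sub>R (v /\<^sub>R norm v)"
    have 1: "v \<bullet> y = b - g * norm v" using v0
      by (simp add: y_def inner_diff_right power2_norm_eq_inner[symmetric] power2_eq_square field_simps)
    have miss: "ball y g \<inter> A = {}"
    proof -
      { fix x assume x: "x \<in> ball y g" "x \<in> A"
        have "v \<bullet> x = v \<bullet> y + v \<bullet> (x - y)" by (simp add: inner_diff_right)
        also have "\<dots> \<le> b - g * norm v + norm v * norm (x - y)"
          using 1 norm_cauchy_schwarz[of v "x - y"] by simp
        also have "\<dots> \<le> b" using x mult_left_mono[of "norm (x - y)" g "norm v"]
          by (simp add: dist_norm norm_minus_commute mult.commute)
        finally have "v \<bullet> x \<le> b" .
        moreover have "v \<bullet> x > b" using vb x hull_subset[of A convex] by blast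
        ultimately have False by simp }
      thus ?thesis by blast
    qed
    show False
    proof (cases "(b - v \<bullet> z) / norm v < 2 * g")
      case True
      have n1: "norm (v /\<^sub>R norm v) = 1" using v0 by simp
      have "z - y = (g - (b - v \<bullet> z) / norm v) *\<^sub>R (v /\<^sub>R norm v)" by (simp add: y_def)
      hence "dist y z = \<bar>g - (b - v \<bullet> z) / norm v\<bar> * norm (v /\<^sub>R norm v)"
        by (metis dist_commute dist_norm norm_scaleR)
      hence "dist y z = \<bar>g - (b - v \<bullet> z) / norm v\<bar>" unfolding n1 by simp
      also have "\<dots> < g" using True vb v0 assms by (simp add: abs_if)
      finally show False using z miss by (auto simp: r_convex_hull_def)
    next
      case False
      have "ball z g \<inter> A = {}"
      proof -
        { fix x assume x: "x \<in> ball z g" "x \<in> A"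
          have "v \<bullet> x = v \<bullet> z + v \<bullet> (x - z)" by (simp add: inner_diff_right)
          also have "\<dots> \<le> v \<bullet> z + norm v * norm (x - z)"
            using norm_cauchy_schwarz[of v "x - z"] by simp
          also have "\<dots> \<le> v \<bullet> z + norm v * g"
            using x by (simp add: dist_norm norm_minus_commute mult_left_mono)
          also have "\<dots> \<le> b"
          proof -
            have "2 * g * norm v \<le> b - v \<bullet> z" using False v0 by (simp add: not_less pos_le_divide_eq)
            moreover have "0 < norm v * g" using v0 assms(3) by simp
            ultimately show ?thesis by (simp add: algebra_simps)
          qed
          finally have "v \<bullet> x \<le> b" .
          moreover have "v \<bullet> x > b" using vb x hull_subset[of A convex] by blast
          ultimately have False by simp }
        thus ?thesis by blast
      qed
      thus False using z assms by (auto simp: r_convex_hull_def)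
    qed
  qed
qed

section \<open>Sets with inner and outer rolling balls\<close>

locale rolling_set =
  fixes S :: "'a::euclidean_space set" and r l :: real
  assumes compact: "compact S" and nonempty: "S \<noteq> {}"
    and r_pos: "0 < r" and l_pos: "0 < l" and rolling: "rolling_R l r S"
begin

lemma closed: "closed S" using compact by (rule compact_imp_closed)

lemma not_UNIV: "S \<noteq> UNIV" using compact not_compact_UNIV by auto

lemma frontier_subset: "frontier S \<subseteq> S" using closed by (rule frontier_subset_closed)

lemma frontier_nonempty: "frontier S \<noteq> {}"
  using nonempty not_UNIV frontier_eq_empty by blast

text \<open>The outer ball of radius \<open>r\<close> and the inner ball of radius \<open>l\<close>
  at \<open>a\<close> are disjoint and both have \<open>a\<close> on their boundary, so by
  \<open>touching_balls\<close> their centers lie on one line through \<open>a\<close>. The vector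
  \<open>u\<close> is the outward normal.\<close>

lemma obtain_normal:
  assumes a: "a \<in> frontier S"
  obtains u where "norm u = 1" "ball (a - l *\<^sub>R u) l \<subseteq> S" "ball (a + r *\<^sub>R u) r \<inter> S = {}"
proof -
  obtain x where x: "a \<in> cball x r" "ball x r \<inter> S = {}"
    using rolling a by (auto simp: rolling_R_def rolling_condition_def)
  have "a \<in> frontier (- S)" using a by (simp add: frontier_complement)
  then obtain c where c: "a \<in> cball c l" "ball c l \<inter> (- S) = {}"
    using rolling by (fastforce simp: rolling_R_def rolling_condition_def)
  have "a \<notin> ball x r" using x a frontier_subset by blast
  hence dx: "dist a x = r" using x by (simp add: dist_commute)
  have "ball c l \<subseteq> S" using c by auto
  hence "ball c l \<subseteq> interior S" by (simp add: interior_maximal)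
  hence "a \<notin> ball c l" using a by (auto simp: frontier_def)
  hence dc: "dist a c = l" using c by (simp add: dist_commute)
  define u where "u = (a - c) /\<^sub>R l"
  have u: "norm u = 1" using dc l_pos by (simp add: u_def dist_norm)
  have "(x - a) /\<^sub>R r = u"
    unfolding u_def using \<open>ball c l \<subseteq> S\<close> x by (intro touching_balls[OF l_pos r_pos _ dc dx]) blast
  hence "r *\<^sub>R u = r *\<^sub>R ((x - a) /\<^sub>R r)" by (rule arg_cong[OF sym])
  also have "\<dots> = x - a" using r_pos by simp
  finally have "x = a + r *\<^sub>R u" by (simp add: algebra_simps)
  moreover have "c = a - l *\<^sub>R u" using l_pos by (simp add: u_def)
  ultimately show ?thesis using that[OF u] \<open>ball c l \<subseteq> S\<close> x by simp
qed

text \<open>For \<open>z\<close> outside \<open>S\<close> let \<open>a\<close> be a nearest point of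
  \<open>S\<close>. The empty ball about \<open>z\<close> touches the inner ball at
  \<open>a\<close>, which puts \<open>z\<close> on the outward normal. The outer ball at
  \<open>a\<close> contains \<open>z\<close> if the distance \<open>e\<close> is below
  \<open>2 * r\<close>; otherwise the ball of radius \<open>r\<close> about \<open>z\<close> is
  empty.\<close>

lemma r_convex_hull_self: "r_convex_hull r S = S"
proof
  show "S \<subseteq> r_convex_hull r S" by (rule r_convex_hull_superset)
  show "r_convex_hull r S \<subseteq> S"
  proof
    fix z assume z: "z \<in> r_convex_hull r S"
    show "z \<in> S"
    proof (rule ccontr)
      assume nz: "z \<notin> S"
      obtain a where a: "a \<in> S" "infdist z S = dist z a"
        using infdist_attains_inf[OF closed nonempty, of z] by blast
      define e where "e = dist a z"
      have e: "e > 0" using a nz by (auto simp: e_def)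
      have miss: "ball z e \<inter> S = {}"
        using a infdist_le[of _ S z] by (fastforce simp: e_def dist_commute)
      have "z \<in> closure (ball z e)" "a \<in> closure (ball z e)" using e by (auto simp: e_def dist_commute)
      hence "a \<in> closure (- S)" using miss closure_mono[of "ball z e" "- S"] by blast
      hence af: "a \<in> frontier S" using a closed by (simp add: frontier_closures)
      obtain u where u: "norm u = 1" "ball (a - l *\<^sub>R u) l \<subseteq> S" "ball (a + r *\<^sub>R u) r \<inter> S = {}"
        using obtain_normal[OF af] .
      have "(z - a) /\<^sub>R e = (a - (a - l *\<^sub>R u)) /\<^sub>R l"
        using miss u e l_pos by (intro touching_balls) (auto simp: dist_norm e_def)
      hence "(z - a) /\<^sub>R e = u" using l_pos by simp
      hence "e *\<^sub>R u = e *\<^sub>R ((z - a) /\<^sub>R e)" by (rule arg_cong[OF sym])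
      also have "\<dots> = z - a" using e by (simp add: scaleR_scaleR)
      finally have zu: "z = a + e *\<^sub>R u" by (simp add: algebra_simps)
      show False
      proof (cases "e < 2 * r")
        case True
        have "z - (a + r *\<^sub>R u) = (e - r) *\<^sub>R u" using zu by (simp add: algebra_simps)
        hence "dist (a + r *\<^sub>R u) z = \<bar>e - r\<bar>" using u by (simp add: dist_norm norm_minus_commute[of _ z])
        hence "z \<in> ball (a + r *\<^sub>R u) r" using True e by (auto simp: abs_if)
        thus False using z u by (auto simp: r_convex_hull_def)
      next
        case False
        hence "ball z r \<subseteq> ball z e" using r_pos by (auto)
        hence "ball z r \<inter> S = {}" using miss by blast
        moreover have "z \<in> ball z r" using r_pos by simp
        ultimately show False using z by (auto simp: r_convex_hull_def)
      qed
    qed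
  qed
qed

text \<open>Unless \<open>z\<close> itself can be the center, let \<open>a\<close> be a nearest
  point of the closure of the complement. The largest ball about \<open>z\<close> in
  \<open>S\<close> touches the outer ball at \<open>a\<close>, so \<open>z\<close> lies on the
  inward normal there, and \<open>c\<close> is the point at depth \<rho> on this normal. For
  \<open>e = 0\<close> the lemma covers every point of \<open>S\<close>.\<close>

lemma deep_point_in_inner_ball:
  assumes z: "z \<in> S" "ball z e \<subseteq> S" and e: "0 \<le> e" "e \<le> \<rho>" "0 < \<rho>" "\<rho> \<le> l"
  obtains c where "ball c \<rho> \<subseteq> S" "dist z c \<le> \<rho> - e"
proof (cases "ball z \<rho> \<subseteq> S")
  case True
  thus ?thesis using that[of z] e by simp
next
  case False
  have ne: "- S \<noteq> {}" using not_UNIV by auto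
  obtain a where a: "a \<in> closure (- S)" "infdist z (closure (- S)) = dist z a"
    using infdist_attains_inf[of "closure (- S)" z] ne by auto
  define e' where "e' = dist z a"
  have in_S: "ball z e' \<subseteq> S"
  proof
    fix w assume w: "w \<in> ball z e'"
    show "w \<in> S"
    proof (rule ccontr)
      assume "w \<notin> S"
      hence "w \<in> closure (- S)" using closure_subset[of "- S"] by blast
      hence "infdist z (closure (- S)) \<le> dist z w" by (rule infdist_le)
      thus False using w a by (simp add: e'_def)
    qed
  qed
  have aS: "a \<in> S"
  proof (cases "e' = 0")
    case True thus ?thesis using z by (simp add: e'_def)
  next
    case False
    hence "a \<in> closure (ball z e')" by (simp add: e'_def)
    thus ?thesis using closure_minimal[OF in_S closed] by blast
  qed
  hence af: "a \<in> frontier S" using a closed by (simp add: frontier_closures)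
  obtain u where u: "norm u = 1" "ball (a - l *\<^sub>R u) l \<subseteq> S" "ball (a + r *\<^sub>R u) r \<inter> S = {}"
    using obtain_normal[OF af] .
  have e'2: "e' < \<rho>"
  proof -
    have "\<not> \<rho> \<le> e'" using False in_S by (meson order_trans subset_ball)
    thus ?thesis by simp
  qed
  have ee': "e \<le> e'"
  proof (rule ccontr)
    assume "\<not> e \<le> e'"
    hence "a \<in> ball z e" by (simp add: e'_def)
    hence "a \<in> interior S" using z(2) by (meson interior_maximal open_ball subsetD)
    thus False using af by (simp add: frontier_def)
  qed
  have zu: "z = a - e' *\<^sub>R u"
  proof (cases "e' = 0")
    case True thus ?thesis by (simp add: e'_def)
  next
    case False
    hence "(a + r *\<^sub>R u - a) /\<^sub>R r = (a - z) /\<^sub>R e'"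
      using in_S u r_pos by (intro touching_balls) (auto simp: dist_norm e'_def norm_minus_commute)
    moreover have "(a + r *\<^sub>R u - a) /\<^sub>R r = u" using r_pos by simp
    ultimately have "e' *\<^sub>R u = e' *\<^sub>R ((a - z) /\<^sub>R e')" by simp
    also have "\<dots> = a - z" using False by simp
    finally show ?thesis by (simp add: algebra_simps)
  qed
  define c where "c = a - \<rho> *\<^sub>R u"
  have "ball c \<rho> \<subseteq> ball (a - l *\<^sub>R u) l"
  proof -
    have "a - l *\<^sub>R u - c = (\<rho> - l) *\<^sub>R u" by (simp add: c_def algebra_simps)
    hence "dist (a - l *\<^sub>R u) c = l - \<rho>" using u e by (simp add: dist_norm)
    thus ?thesis by (simp add: ball_subset_ball_iff dist_commute)
  qed
  hence "ball c \<rho> \<subseteq> S" using u by blast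
  moreover have "dist z c \<le> \<rho> - e"
  proof -
    have "z - c = (\<rho> - e') *\<^sub>R u" by (simp add: c_def zu algebra_simps)
    thus ?thesis using u e'2 ee' by (simp add: dist_norm)
  qed
  ultimately show ?thesis by (rule that)
qed

text \<open>The inner and the outer ball are disjoint, so their centers are at least
  \<open>l + r\<close> apart. For small \<open>dist a b\<close> this forces
  \<open>l *\<^sub>R u + r *\<^sub>R v\<close> to have almost the length \<open>l + r\<close>, which
  bounds the angle between the normals.\<close>

lemma normals_close:
  assumes "norm u = 1" "norm v = 1"
    and "ball (a - l *\<^sub>R u) l \<subseteq> S" "ball (b + r *\<^sub>R v) r \<inter> S = {}"
    and h: "dist a b \<le> r * l / (2 * (l + r))"
  shows "u \<bullet> v \<ge> 1 / 2"
proof -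
  let ?h = "dist a b"
  have "l + r \<le> dist (a - l *\<^sub>R u) (b + r *\<^sub>R v)"
    using assms r_pos l_pos by (intro ball_disjoint_dist) auto
  also have "\<dots> = norm ((a - b) - (l *\<^sub>R u + r *\<^sub>R v))" by (simp add: dist_norm algebra_simps)
  also have "\<dots> \<le> ?h + norm (l *\<^sub>R u + r *\<^sub>R v)" unfolding dist_norm by (rule norm_triangle_ineq4)
  finally have 1: "l + r - ?h \<le> norm (l *\<^sub>R u + r *\<^sub>R v)" by simp
  have "r * l / (2 * (l + r)) \<le> l + r"
  proof -
    have "r * l \<le> (l + r) * (2 * (l + r))" using r_pos l_pos by (simp add: algebra_simps)
    thus ?thesis using r_pos l_pos by (simp add: divide_le_eq)
  qed
  hence "0 \<le> l + r - ?h" using h by simp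
  hence "(l + r - ?h)\<^sup>2 \<le> (norm (l *\<^sub>R u + r *\<^sub>R v))\<^sup>2" using 1 by (intro power_mono)
  also have "\<dots> = l\<^sup>2 + r\<^sup>2 + 2 * l * r * (u \<bullet> v)"
    using assms(1,2) unfolding power2_norm_eq_inner
    by (simp add: norm_eq_1 inner_add_left inner_add_right inner_commute[of v u] power2_eq_square algebra_simps)
  finally have "2 * l * r * (1 - u \<bullet> v) \<le> 2 * ?h * (l + r)"
    by (simp add: power2_eq_square algebra_simps) (insert zero_le_square[of ?h], linarith)
  also have "\<dots> \<le> r * l" using h r_pos l_pos by (simp add: field_simps)
  finally have "r * l * (2 * (1 - u \<bullet> v)) \<le> r * l * 1" by (simp add: algebra_simps)
  hence "2 * (1 - u \<bullet> v) \<le> 1" using r_pos l_pos mult_pos_pos[of r l] by (simp only: mult_le_cancel_left_pos)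
  thus ?thesis by simp
qed

end

section \<open>Volumes of nets, shells and lenses\<close>

lemma borel_bounded_fmeasurable:
  fixes A :: "'a::euclidean_space set"
  shows "A \<in> sets borel \<Longrightarrow> bounded A \<Longrightarrow> A \<in> fmeasurable lborel"
  by (auto intro!: fmeasurableI emeasure_bounded_finite)

lemma measure_mono_bounded:
  fixes A :: "'a::euclidean_space set"
  assumes "A \<subseteq> B" "A \<in> sets borel" "B \<in> sets borel" "bounded B"
  shows "measure lborel A \<le> measure lborel B"
  using assms by (intro measure_mono_fmeasurable borel_bounded_fmeasurable) auto

lemma translate_borel:
  fixes A :: "'a::euclidean_space set"
  assumes "A \<in> sets borel"
  shows "(+) v ` A \<in> sets borel"
proof -
  have "(+) v ` A = (\<lambda>x. x - v) -` A \<inter> space borel"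
    by (auto simp: image_iff) (metis add.commute diff_add_cancel)
  also have "\<dots> \<in> sets borel" using assms by (intro measurable_sets[where A=borel]) auto
  finally show ?thesis .
qed

lemma measure_translate:
  fixes A :: "'a::euclidean_space set"
  assumes "A \<in> sets borel"
  shows "measure lborel ((+) v ` A) = measure lborel A"
  using measure_translation[of v A] assms translate_borel[OF assms, of v] by simp

text \<open>A \<delta>-separated subset of the ball of largest cardinality is a net. The maximum
  exists because the disjoint balls of radius \<open>\<delta> / 2\<close> about its points fit into
  a ball of radius \<open>R + \<delta> / 2\<close>.\<close>

lemma exists_finite_net:
  assumes "0 < \<delta>" "0 \<le> R"
  obtains G :: "'a::euclidean_space set" where "finite G" "cball 0 R \<subseteq> (\<Union>g\<in>G. cball g \<delta>)"
    "real (card G) \<le> ((2 * R + \<delta>) / \<delta>) ^ DIM('a)"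
proof -
  define P where "P G \<longleftrightarrow> finite G \<and> G \<subseteq> cball (0::'a) R \<and> (\<forall>x\<in>G. \<forall>y\<in>G. x \<noteq> y \<longrightarrow> \<delta> \<le> dist x y)" for G
  let ?B = "((2 * R + \<delta>) / \<delta>) ^ DIM('a)"
  let ?w = "unit_ball_vol (real DIM('a))"
  have card: "real (card G) \<le> ?B" if "P G" for G
  proof -
    have "disjoint_family_on (\<lambda>g. ball g (\<delta> / 2)) G"
      unfolding disjoint_family_on_def
    proof (intro ballI impI)
      fix x y assume "x \<in> G" "y \<in> G" "x \<noteq> y"
      hence "\<delta> \<le> dist x y" using that by (auto simp: P_def)
      thus "ball x (\<delta> / 2) \<inter> ball y (\<delta> / 2) = {}" by (intro disjoint_ballI) simp
    qed
    hence "measure lborel (\<Union>g\<in>G. ball g (\<delta> / 2)) = (\<Sum>g\<in>G. measure lborel (ball g (\<delta> / 2)))"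
      using that emeasure_bounded_finite[OF bounded_ball]
      by (intro measure_finite_Union) (auto simp: P_def top.not_eq_extremum)
    also have "\<dots> = real (card G) * (?w * (\<delta> / 2) ^ DIM('a))"
      using assms by (simp add: content_ball)
    finally have 1: "measure lborel (\<Union>g\<in>G. ball g (\<delta> / 2)) = real (card G) * (?w * (\<delta> / 2) ^ DIM('a))" .
    have "(\<Union>g\<in>G. ball g (\<delta> / 2)) \<subseteq> ball 0 (R + \<delta> / 2)"
    proof (clarsimp simp: dist_norm)
      fix g x assume "g \<in> G" "norm (g - x) * 2 < \<delta>"
      moreover have "norm g \<le> R" using \<open>g \<in> G\<close> that by (auto simp: P_def)
      ultimately show "norm x < R + \<delta> / 2" using norm_triangle_ineq[of g "x - g"] by (simp add: norm_minus_commute)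
    qed
    hence "measure lborel (\<Union>g\<in>G. ball g (\<delta> / 2)) \<le> measure lborel (ball (0::'a) (R + \<delta> / 2))"
      by (intro measure_mono_bounded) (auto intro!: borel_open)
    also have "\<dots> = ?w * (R + \<delta> / 2) ^ DIM('a)" using assms by (simp add: content_ball)
    finally have "real (card G) * (?w * (\<delta> / 2) ^ DIM('a)) \<le> ?w * (R + \<delta> / 2) ^ DIM('a)" using 1 by simp
    hence "real (card G) * (\<delta> / 2) ^ DIM('a) \<le> (R + \<delta> / 2) ^ DIM('a)"
      using unit_ball_vol_pos[of "real DIM('a)"] by (simp add: mult.left_commute)
    also have "R + \<delta> / 2 = (2 * R + \<delta>) / \<delta> * (\<delta> / 2)" using assms by (simp add: field_simps)
    also have "\<dots> ^ DIM('a) = ?B * (\<delta> / 2) ^ DIM('a)" by (rule power_mult_distrib)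
    finally show ?thesis using assms by simp
  qed
  obtain b where b: "?B < real b" using reals_Archimedean2 by blast
  have "P {}" by (simp add: P_def)
  moreover have "\<forall>G. P G \<longrightarrow> card G < b"
  proof (intro allI impI)
    fix G assume "P G"
    from le_less_trans[OF card[OF this] b] show "card G < b" by simp
  qed
  ultimately obtain G where G: "P G" "\<And>H. P H \<Longrightarrow> card H \<le> card G"
    using ex_has_greatest_nat[of P "{}" card] by blast
  have "cball 0 R \<subseteq> (\<Union>g\<in>G. cball g \<delta>)"
  proof (rule ccontr)
    assume "\<not> ?thesis"
    then obtain x where x: "x \<in> cball 0 R" "\<forall>g\<in>G. \<delta> < dist g x" by fastforce
    have "P (insert x G)" using G(1) x by (auto simp: P_def dist_commute intro: less_imp_le)
    hence "card (insert x G) \<le> card G" by (rule G)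
    moreover have "x \<notin> G" using x assms by fastforce
    ultimately show False using G(1) by (simp add: P_def)
  qed
  thus ?thesis using that[of G] G(1) card by (auto simp: P_def)
qed

text \<open>The \<open>m + 1\<close> translates by multiples of \<open>v\<close> fit into the
  enlarged ball. A common point of two of them is excluded by \<open>disj\<close> at the difference
  of the indices.\<close>

lemma disjoint_translates_measure_bound:
  fixes T :: "'a::euclidean_space set"
  assumes T: "T \<in> sets borel" "T \<subseteq> cball 0 R" "real m * norm v \<le> b"
    and disj: "\<And>k z. 1 \<le> k \<Longrightarrow> k \<le> m \<Longrightarrow> z \<in> T \<Longrightarrow> z + real k *\<^sub>R v \<notin> T"
  shows "real (m + 1) * measure lborel T \<le> measure lborel (cball (0::'a) (R + b))"
proof -
  define F where "F k = (+) (real k *\<^sub>R v) ` T" for k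
  have F: "F k \<in> sets borel" for k unfolding F_def using T by (intro translate_borel)
  have sub: "F k \<subseteq> cball 0 (R + b)" if "k \<le> m" for k
  proof -
    have "real k * norm v \<le> real m * norm v" using that by (intro mult_right_mono) auto
    hence n: "norm (real k *\<^sub>R v) \<le> b" using T by simp
    show ?thesis
    proof (clarsimp simp: F_def)
      fix z assume "z \<in> T"
      hence "norm z \<le> R" using T by auto
      thus "norm (real k *\<^sub>R v + z) \<le> R + b" using n norm_triangle_ineq[of "real k *\<^sub>R v" z] by linarith
    qed
  qed
  have dis: "F i \<inter> F j = {}" if "i < j" "j \<le> m" for i j
  proof (rule ccontr)
    assume "F i \<inter> F j \<noteq> {}"
    then obtain z z' where z: "z \<in> T" "z' \<in> T" "real i *\<^sub>R v + z = real j *\<^sub>R v + z'"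
      by (auto simp: F_def)
    have "z' + real (j - i) *\<^sub>R v = z" using z(3) that
      by (simp add: of_nat_diff algebra_simps)
    moreover have "1 \<le> j - i" "j - i \<le> m" using that by auto
    ultimately show False using disj[of "j - i" z'] z by metis
  qed
  have "disjoint_family_on F {..m}" unfolding disjoint_family_on_def
    by (metis dis atMost_iff inf_commute linorder_neqE_nat)
  moreover have "emeasure lborel (F i) \<noteq> \<infinity>" if "i \<le> m" for i
    using emeasure_bounded_finite[OF bounded_subset[OF bounded_cball sub[OF that]]] by simp
  ultimately have "measure lborel (\<Union>k\<in>{..m}. F k) = (\<Sum>k\<in>{..m}. measure lborel (F k))"
    using F by (intro measure_finite_Union) auto
  also have "\<dots> = real (m + 1) * measure lborel T"
    using T by (simp add: F_def measure_translate)
  finally have "real (m + 1) * measure lborel T = measure lborel (\<Union>k\<in>{..m}. F k)" by simp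
  also have "\<dots> \<le> measure lborel (cball (0::'a) (R + b))"
    using sub F by (intro measure_mono_bounded) auto
  finally show ?thesis .
qed

section \<open>Boundary shells\<close>

definition erosion :: "real \<Rightarrow> 'a::metric_space set \<Rightarrow> 'a set" where
  "erosion e S = {z. ball z e \<subseteq> S}"

text \<open>Since open balls are used, the complement is the union of the open balls of radius
  \<open>e\<close> about the points outside \<open>S\<close>.\<close>

lemma closed_erosion: "closed (erosion e S)"
proof -
  have "- erosion e S = (\<Union>w\<in>- S. ball w e)"
    by (auto simp: erosion_def dist_commute)
  thus ?thesis by (metis closed_def open_UN open_ball)
qed

context rolling_set
begin

lemma borel: "S \<in> sets borel" using closed by (rule borel_closed)

lemma bounded: "bounded S" using compact by (rule compact_imp_bounded)

lemma measure_pos: "0 < measure lborel S"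
proof -
  obtain a where "a \<in> frontier S" using frontier_nonempty by blast
  then obtain u where "ball (a - l *\<^sub>R u) l \<subseteq> S" using obtain_normal by metis
  hence "measure lborel (ball (a - l *\<^sub>R u) l) \<le> measure lborel S"
    using borel bounded by (intro measure_mono_bounded) auto
  moreover have "0 < measure lborel (ball (a - l *\<^sub>R u) l)"
    using l_pos by (simp add: content_ball)
  ultimately show ?thesis by linarith
qed

text \<open>Near \<open>a0\<close> all normals make an angle of at most 60 degrees with the normal \<open>u0\<close> at \<open>a0\<close>, so moving
  a shell point by \<open>8 * e\<close> or more along \<open>- u0\<close> leads out of the shell. The translates of the shell
  by multiples of \<open>8 * e\<close> are therefore disjoint, and about \<open>l / (16 * e)\<close> of them fit into a bounded set.\<close>

lemma local_shell_measure:
  assumes a0: "a0 \<in> frontier S" and e: "0 < e" "e \<le> r * l / (4 * (l + r))" and R: "S \<subseteq> cball 0 R"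
  shows "measure lborel ((S - erosion e S) \<inter> ball a0 (r * l / (4 * (l + r))))
    \<le> 16 * measure lborel (cball (0::'a) (R + l / 2)) / l * e"
proof -
  \<comment> \<open>Half the distance allowed in \<open>normals_close\<close>: the way from
    \<open>a0\<close> to a shell point and the way on to a nearby frontier point each use up one
    \<eta>.\<close>
  define \<eta> where "\<eta> = r * l / (4 * (l + r))"
  define T where "T = (S - erosion e S) \<inter> ball a0 \<eta>"
  obtain u0 where u0: "norm u0 = 1" "ball (a0 - l *\<^sub>R u0) l \<subseteq> S" "ball (a0 + r *\<^sub>R u0) r \<inter> S = {}"
    using obtain_normal[OF a0] .
  \<comment> \<open>The number of steps of length \<open>8 * e\<close> that fit into
    \<open>l / 2\<close>.\<close>
  define m where "m = nat \<lfloor>l / (16 * e)\<rfloor>"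
  define v where "v = - (8 * e) *\<^sub>R u0"
  have m1: "real m \<le> l / (16 * e)" using l_pos e by (simp add: m_def)
  have m2: "l / (16 * e) \<le> real (m + 1)" using l_pos e unfolding m_def by linarith
  have nv: "real m * norm v \<le> l / 2"
    using m1 e u0 by (simp add: v_def field_simps)
  have disj: "z + real k *\<^sub>R v \<notin> T" if k: "1 \<le> k" "k \<le> m" and z: "z \<in> T" for k z
  proof -
    have "z \<in> S" "\<not> ball z e \<subseteq> S" using z by (auto simp: T_def erosion_def)
    then obtain a where a: "a \<in> frontier S" "dist z a < e" using ball_subset_frontier by metis
    obtain u where u: "norm u = 1" "ball (a - l *\<^sub>R u) l \<subseteq> S" "ball (a + r *\<^sub>R u) r \<inter> S = {}"
      using obtain_normal[OF a(1)] .
    have "dist a a0 \<le> dist z a + dist a0 z" by (metis dist_commute dist_triangle add.commute)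
    also have "dist z a \<le> \<eta>" using a e by (simp add: \<eta>_def)
    also have "dist a0 z \<le> \<eta>" using z by (simp add: T_def)
    finally have "dist a a0 \<le> \<eta> + \<eta>" by simp
    also have "\<dots> = r * l / (2 * (l + r))" using r_pos l_pos by (simp add: \<eta>_def divide_simps)
    finally have uu: "u \<bullet> u0 \<ge> 1 / 2" using u u0 by (intro normals_close) auto
    define s where "s = 8 * e * real k"
    have s1: "8 * e \<le> s" using k e by (simp add: s_def)
    have "s \<le> real m * norm v" using k e u0 by (simp add: s_def v_def)
    hence s2: "s \<le> l / 2" using nv by simp
    have "8 * e * (l / 2) \<le> s * (l - s)" using s1 s2 e by (intro mult_mono) auto
    hence sl: "4 * e * l \<le> s * l - s * s" by (simp add: algebra_simps)
    \<comment> \<open>The angle bound makes the square at most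
      \<open>l\<^sup>2 - l * s + s\<^sup>2\<close>, and \<open>8 * e \<le> s \<le> l / 2\<close>
      makes this at most \<open>(l - 2 * e)\<^sup>2\<close>. So the moved point is within
      \<open>l - e\<close> of the center of the inner ball at \<open>a\<close>, hence at depth
      \<open>e\<close>.\<close>
    have "(norm (l *\<^sub>R u - s *\<^sub>R u0))\<^sup>2 = l\<^sup>2 - 2 * l * s * (u \<bullet> u0) + s\<^sup>2"
      using u(1) u0(1) unfolding power2_norm_eq_inner
      by (simp add: norm_eq_1 inner_diff_left inner_diff_right inner_commute[of u0 u] power2_eq_square algebra_simps)
    also have "\<dots> \<le> l\<^sup>2 - 2 * l * s * (1 / 2) + s\<^sup>2"
      using mult_left_mono[OF uu, of "2 * l * s"] l_pos s1 e by simp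
    also have "\<dots> \<le> (l - 2 * e)\<^sup>2"
    proof -
      have "(l - 2 * e)\<^sup>2 = l\<^sup>2 - 4 * e * l + 4 * (e * e)" by (simp add: power2_eq_square algebra_simps)
      moreover have "l\<^sup>2 - 2 * l * s * (1 / 2) + s\<^sup>2 = l\<^sup>2 - (s * l - s * s)" by (simp add: power2_eq_square)
      moreover have "0 \<le> e * e" by simp
      ultimately show ?thesis using sl by linarith
    qed
    finally have nsq: "(norm (l *\<^sub>R u - s *\<^sub>R u0))\<^sup>2 \<le> (l - 2 * e)\<^sup>2" .
    have "0 \<le> l - 2 * e" using s1 s2 e by linarith
    with nsq have "norm (l *\<^sub>R u - s *\<^sub>R u0) \<le> l - 2 * e" by (rule power2_le_imp_le)
    moreover have "z - s *\<^sub>R u0 - (a - l *\<^sub>R u) = (z - a) + (l *\<^sub>R u - s *\<^sub>R u0)" by simp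
    hence "dist (z - s *\<^sub>R u0) (a - l *\<^sub>R u) \<le> dist z a + norm (l *\<^sub>R u - s *\<^sub>R u0)"
      by (metis dist_norm norm_triangle_ineq)
    ultimately have "dist (z - s *\<^sub>R u0) (a - l *\<^sub>R u) \<le> l - e" using a by linarith
    hence "ball (z - s *\<^sub>R u0) e \<subseteq> ball (a - l *\<^sub>R u) l"
      by (simp add: ball_subset_ball_iff)
    hence "z - s *\<^sub>R u0 \<in> erosion e S" using u by (auto simp: erosion_def)
    moreover have "z + real k *\<^sub>R v = z - s *\<^sub>R u0" by (simp add: v_def s_def mult.commute)
    ultimately show ?thesis by (simp add: T_def)
  qed
  have T: "T \<in> sets borel"
    unfolding T_def by (intro sets.Int sets.Diff borel borel_closed[OF closed_erosion]) auto
  have TR: "T \<subseteq> cball 0 R" using R by (auto simp: T_def subset_eq)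
  have "real (m + 1) * measure lborel T \<le> measure lborel (cball (0::'a) (R + l / 2))"
    by (rule disjoint_translates_measure_bound[OF T TR nv disj])
  moreover have "l / (16 * e) * measure lborel T \<le> real (m + 1) * measure lborel T"
    using m2 by (intro mult_right_mono) auto
  ultimately have "l / (16 * e) * measure lborel T \<le> measure lborel (cball (0::'a) (R + l / 2))" by linarith
  thus ?thesis using l_pos e unfolding T_def \<eta>_def by (simp add: field_simps)
qed

text \<open>By compactness finitely many local bounds cover the frontier and add up. The second
  summand of the constant handles large \<open>e\<close>, where the shell is estimated by all of
  \<open>S\<close>.\<close>

lemma shell_measure:
  obtains C where "0 < C" "\<And>e. 0 < e \<Longrightarrow> measure lborel (S - erosion e S) \<le> C * e"
proof -
  define \<eta> where "\<eta> = r * l / (4 * (l + r))"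
  have \<eta>: "\<eta> > 0" using r_pos l_pos by (simp add: \<eta>_def)
  obtain R where R: "S \<subseteq> cball 0 R" using bounded by (auto simp: bounded_iff subset_eq)
  have "compact (frontier S)" using compact by (rule compact_frontier)
  moreover have "frontier S \<subseteq> (\<Union>a\<in>frontier S. ball a (\<eta> / 2))" using \<eta> by auto
  ultimately obtain N where N: "N \<subseteq> frontier S" "finite N" "frontier S \<subseteq> (\<Union>a\<in>N. ball a (\<eta> / 2))"
    using compactE_image[of "frontier S" "frontier S" "\<lambda>a. ball a (\<eta> / 2)"] by auto
  define K where "K = 16 * measure lborel (cball (0::'a) (R + l / 2)) / l"
  have K: "K \<ge> 0" using l_pos by (simp add: K_def)
  define C where "C = real (card N) * K + measure lborel S / (\<eta> / 2)"
  have C: "C > 0" using K \<eta> measure_pos by (simp add: C_def add_nonneg_pos)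
  have meas: "S - erosion e S \<in> sets borel" for e using borel borel_closed[OF closed_erosion] by auto
  have "measure lborel (S - erosion e S) \<le> C * e" if e: "0 < e" for e
  proof (cases "e \<le> \<eta> / 2")
    case True
    hence "e \<le> \<eta>" using \<eta> by simp
    define T where "T a = (S - erosion e S) \<inter> ball a \<eta>" for a
    have "S - erosion e S \<subseteq> (\<Union>a\<in>N. T a)"
    proof
      fix z assume z: "z \<in> S - erosion e S"
      then obtain b where b: "b \<in> frontier S" "dist z b < e"
        using ball_subset_frontier[of z S e] by (auto simp: erosion_def)
      then obtain a where a: "a \<in> N" "dist a b < \<eta> / 2" using N by auto
      have "dist a z \<le> dist a b + dist z b" by (rule dist_triangle2)
      hence "dist a z < \<eta>" using a b True by linarith
      thus "z \<in> (\<Union>a\<in>N. T a)" using z a by (auto simp: T_def)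
    qed
    hence "measure lborel (S - erosion e S) \<le> measure lborel (\<Union>a\<in>N. T a)"
    proof (rule measure_mono_bounded)
      show "(\<Union>a\<in>N. T a) \<in> sets borel" using meas N(2) by (intro sets.finite_UN) (auto simp: T_def)
      show "bounded (\<Union>a\<in>N. T a)" using bounded by (rule bounded_subset) (auto simp: T_def)
    qed (use meas in auto)
    also have "\<dots> \<le> (\<Sum>a\<in>N. measure lborel (T a))"
      using meas N(2) by (intro measure_UNION_le) (auto simp: T_def)
    also have "\<dots> \<le> (\<Sum>a\<in>N. K * e)"
      unfolding T_def K_def \<eta>_def using N R e \<open>e \<le> \<eta>\<close>[unfolded \<eta>_def] by (intro sum_mono local_shell_measure) auto
    also have "\<dots> \<le> C * e" using measure_pos \<eta> e by (simp add: C_def algebra_simps)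
    finally show ?thesis .
  next
    case False
    have "measure lborel (S - erosion e S) \<le> measure lborel S"
      using meas borel bounded by (intro measure_mono_bounded) auto
    also have "\<dots> \<le> measure lborel S / (\<eta> / 2) * e"
      using False \<eta> mult_left_mono[of "\<eta> / 2" e "measure lborel S"] by (simp add: field_simps)
    also have "\<dots> \<le> C * e" using K e by (intro mult_right_mono) (auto simp: C_def)
    finally show ?thesis .
  qed
  thus ?thesis using C that by blast
qed

end

text \<open>The ball is covered by at most \<open>8 * R / e\<close> translates of its central slab: translating a parallel
  slice of the ball to the center along \<open>v\<close> keeps it inside the ball.\<close>

lemma slab_volume:
  fixes m v :: "'a::euclidean_space"
  assumes v: "norm v = 1" and e: "0 < e" "e \<le> 2 * R"
  shows "unit_ball_vol (real DIM('a)) * R ^ DIM('a) * e / (8 * R)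
    \<le> measure lborel {x \<in> ball m R. \<bar>(x - m) \<bullet> v\<bar> \<le> e / 4}" (is "_ \<le> measure lborel ?T")
proof -
  have R: "0 < R" using e by simp
  define J where "J = \<lfloor>2 * R / e + 1 / 2\<rfloor>"
  define F where "F j = (+) ((real_of_int j * e / 2) *\<^sub>R v) ` ?T" for j
  have T: "?T \<in> sets borel" by measurable
  have F: "F j \<in> sets borel" for j unfolding F_def using T by (rule translate_borel)
  have sub: "ball m R \<subseteq> (\<Union>j\<in>{-J..J}. F j)"
  proof
    fix p assume p: "p \<in> ball m R"
    define t where "t = (p - m) \<bullet> v"
    define \<tau> where "\<tau> = 2 * t / e"
    \<comment> \<open>The slices are spaced \<open>e / 2\<close> apart, so rounding leaves a height
      of at most \<open>e / 4\<close>.\<close>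
    define j where "j = round \<tau>"
    define q where "q = p - (real_of_int j * e / 2) *\<^sub>R v"
    have j: "\<bar>real_of_int j - \<tau>\<bar> \<le> 1 / 2" unfolding j_def by (rule of_int_round_abs_le)
    have te: "t = \<tau> * e / 2" using e by (simp add: \<tau>_def)
    have "\<bar>t\<bar> \<le> norm (p - m)" using Cauchy_Schwarz_ineq2[of "p - m" v] v by (simp add: t_def)
    also have "\<dots> < R" using p by (simp add: dist_norm norm_minus_commute)
    finally have "\<bar>\<tau>\<bar> \<le> 2 * R / e" using e by (simp add: \<tau>_def abs_mult divide_right_mono)
    hence "\<bar>real_of_int j\<bar> \<le> 2 * R / e + 1 / 2" using j by linarith
    hence "\<bar>j\<bar> \<le> J" unfolding J_def by (simp add: le_floor_iff)
    hence jJ: "j \<in> {-J..J}" by auto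
    have vv: "v \<bullet> v = 1" using v by (simp add: norm_eq_1)
    have qv: "(q - m) \<bullet> v = (\<tau> - real_of_int j) * e / 2"
      using vv te by (simp add: q_def t_def inner_diff_left algebra_simps)
    have 1: "\<bar>(q - m) \<bullet> v\<bar> \<le> e / 4"
      unfolding qv using j e mult_right_mono[OF j, of "e / 2"] by (simp add: abs_mult abs_minus_commute)
    \<comment> \<open>A nonzero \<open>j\<close> has the sign of \<tau> and absolute value at most
      \<open>2 * \<bar>\<tau>\<bar>\<close>. This is what keeps the translated point
      \<open>q\<close> in the ball.\<close>
    have jt: "(real_of_int j)\<^sup>2 \<le> 2 * real_of_int j * \<tau>"
    proof -
      consider "j = 0" | "j \<ge> 1" | "j \<le> - 1" by linarith
      thus ?thesis
      proof cases
        case 2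
        hence "real_of_int j \<le> 2 * \<tau>" using j by linarith
        thus ?thesis using 2 mult_left_mono[of "real_of_int j" "2 * \<tau>" "real_of_int j"] by (simp add: power2_eq_square algebra_simps)
      next
        case 3
        hence "2 * \<tau> \<le> real_of_int j" using j by linarith
        thus ?thesis using 3 mult_left_mono_neg[of "2 * \<tau>" "real_of_int j" "real_of_int j"] by (simp add: power2_eq_square algebra_simps)
      qed simp
    qed
    have "(norm (q - m))\<^sup>2 = (norm (p - m))\<^sup>2 + e\<^sup>2 / 4 * ((real_of_int j)\<^sup>2 - 2 * real_of_int j * \<tau>)"
    proof -
      have "(norm (w - k *\<^sub>R v))\<^sup>2 = (norm w)\<^sup>2 - 2 * k * (w \<bullet> v) + k\<^sup>2" for w k
        unfolding power2_norm_eq_inner using vv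
        by (simp add: inner_diff_left inner_diff_right inner_commute[of v w] power2_eq_square algebra_simps)
      from this[of "p - m" "real_of_int j * e / 2"]
      have "(norm (q - m))\<^sup>2 = (norm (p - m))\<^sup>2 - 2 * (real_of_int j * e / 2) * t + (real_of_int j * e / 2)\<^sup>2"
        by (simp only: q_def t_def diff_diff_eq add.commute[of m])
      thus ?thesis unfolding te by (simp add: power2_eq_square field_simps)
    qed
    also have "\<dots> \<le> (norm (p - m))\<^sup>2" using jt by (simp add: mult_nonneg_nonpos)
    finally have "norm (q - m) \<le> norm (p - m)" by (rule power2_le_imp_le) simp
    hence "q \<in> ?T" using 1 p by (auto simp: dist_norm norm_minus_commute)
    moreover have "p = (real_of_int j * e / 2) *\<^sub>R v + q" by (simp add: q_def)
    ultimately have "p \<in> F j" by (auto simp: F_def)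
    thus "p \<in> (\<Union>j\<in>{-J..J}. F j)" using jJ by blast
  qed
  have bF: "bounded (F j)" for j
    unfolding F_def by (rule bounded_translation) (rule bounded_subset[of "ball m R"], auto)
  have "unit_ball_vol (real DIM('a)) * R ^ DIM('a) = measure lborel (ball m R)"
    using R by (simp add: content_ball)
  also have "\<dots> \<le> measure lborel (\<Union>j\<in>{-J..J}. F j)"
    using sub F bF by (intro measure_mono_bounded) (auto simp: bounded_UN)
  also have "\<dots> \<le> (\<Sum>j\<in>{-J..J}. measure lborel (F j))"
    using F by (intro measure_UNION_le) auto
  also have "\<dots> = real (nat (2 * J + 1)) * measure lborel ?T"
    using T by (simp add: F_def measure_translate)
  also have "\<dots> \<le> (8 * R / e) * measure lborel ?T"
  proof (rule mult_right_mono)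
    have "real_of_int J \<le> 2 * R / e + 1 / 2" by (simp add: J_def)
    moreover have "1 \<le> 2 * R / e" using e by simp
    ultimately have "2 * real_of_int J + 1 \<le> 8 * R / e" by linarith
    thus "real (nat (2 * J + 1)) \<le> 8 * R / e" using R e by (cases "2 * J + 1 \<ge> 0") auto
  qed simp
  finally show ?thesis using R e by (simp add: field_simps)
qed

text \<open>The lens has thickness at least \<open>e\<close> along the line of centers and width of
  order \<open>sqrt (\<rho> * e)\<close> in the remaining directions. This produces the exponent
  \<open>(DIM('a) + 1) / 2\<close>, and with it the rate of the theorem.\<close>

lemma lens_volume:
  fixes c y :: "'a::euclidean_space"
  assumes e: "0 < e" "e \<le> \<rho>" and d: "dist c y \<le> 2 * \<rho> - e"
  shows "unit_ball_vol (real DIM('a)) / 8 * (sqrt \<rho> / 2) ^ (DIM('a) - 1) * e powr ((real DIM('a) + 1) / 2)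
    \<le> measure lborel (ball c \<rho> \<inter> ball y \<rho>)"
proof -
  define m where "m = midpoint c y"
  obtain v where v: "norm v = 1" "y - c = dist c y *\<^sub>R v"
  proof (cases "c = y")
    case True
    obtain b :: 'a where "b \<in> Basis" using nonempty_Basis by blast
    thus ?thesis using that[of b] True by simp
  next
    case False
    thus ?thesis using that[of "(y - c) /\<^sub>R dist c y"] by (simp add: dist_norm norm_minus_commute)
  qed
  define h where "h = dist c y / 2"
  have h: "0 \<le> h" "h \<le> \<rho> - e / 2" using d by (auto simp: h_def)
  have mc: "m - c = h *\<^sub>R v" "m - y = (- h) *\<^sub>R v"
  proof -
    have "m - c = (1 / 2) *\<^sub>R (y - c)" by (simp add: m_def midpoint_def algebra_simps) (simp add: scaleR_left_distrib[symmetric])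
    thus "m - c = h *\<^sub>R v" using v by (simp add: h_def)
    have "m - y = - (1 / 2) *\<^sub>R (y - c)" by (simp add: m_def midpoint_def algebra_simps) (simp add: scaleR_left_distrib[symmetric])
    thus "m - y = (- h) *\<^sub>R v" using v by (simp add: h_def)
  qed
  \<comment> \<open>the lens contains a flat cylinder of half-height \<open>e / 4\<close> and radius \<open>R\<close> about its midpoint\<close>
  define R where "R = sqrt (\<rho> * e) / 2"
  have rho: "0 < \<rho>" using e by simp
  have R: "R > 0" "R\<^sup>2 = \<rho> * e / 4" using rho e by (auto simp: R_def power_divide)
  have "e = sqrt (e * e)" using e by (simp add: real_sqrt_mult)
  also have "\<dots> \<le> sqrt (\<rho> * e)" using e by (intro real_sqrt_le_mono mult_right_mono) auto
  finally have eR: "e \<le> 2 * R" by (simp add: R_def)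
  let ?T = "{x \<in> ball m R. \<bar>(x - m) \<bullet> v\<bar> \<le> e / 4}"
  \<comment> \<open>One computation serves both centers, which lie at distance \<open>h\<close> on
    either side of \<open>m\<close>.\<close>
  have close: "norm (x - w) < \<rho>" if x: "x \<in> ?T" and w: "m - w = k *\<^sub>R v" "\<bar>k\<bar> = h" for x w k
  proof -
    have xm: "(norm (x - m))\<^sup>2 < \<rho> * e / 4"
      using x power_strict_mono[of "norm (x - m)" R 2] R by (simp add: dist_norm norm_minus_commute)
    have xw: "x - w = (x - m) + k *\<^sub>R v" using w(1) by (simp add: algebra_simps)
    have eq: "(norm (x - w))\<^sup>2 = (norm (x - m))\<^sup>2 + 2 * (k * ((x - m) \<bullet> v)) + k\<^sup>2"
      unfolding power2_norm_eq_inner xw using v(1)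
      by (simp add: norm_eq_1 inner_add_left[of "x - m"] inner_add_right[of _ "x - m"] inner_commute[of v "x - m"] power2_eq_square distrib_left)
    have "k * ((x - m) \<bullet> v) \<le> \<bar>k\<bar> * \<bar>(x - m) \<bullet> v\<bar>" by (metis abs_ge_self abs_mult)
    also have "\<dots> \<le> h * (e / 4)" using x w h by (intro mult_mono) auto
    also have "\<dots> \<le> (\<rho> - e / 2) * (e / 4)" using h e by (intro mult_right_mono) auto
    finally have cross: "k * ((x - m) \<bullet> v) \<le> (\<rho> - e / 2) * (e / 4)" .
    have "k\<^sup>2 = h\<^sup>2" using w(2) by (metis power2_abs)
    also have "h\<^sup>2 \<le> (\<rho> - e / 2)\<^sup>2" using h by (intro power_mono) auto
    finally have "(norm (x - w))\<^sup>2 < \<rho> * e / 4 + 2 * ((\<rho> - e / 2) * (e / 4)) + (\<rho> - e / 2)\<^sup>2"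
      using eq xm cross by linarith
    also have "\<dots> = \<rho>\<^sup>2 - \<rho> * e / 4" by (simp add: power2_eq_square algebra_simps)
    also have "\<dots> \<le> \<rho>\<^sup>2" using rho e by simp
    finally show ?thesis using rho by (intro power2_less_imp_less[of "norm (x - w)"]) auto
  qed
  have sub: "?T \<subseteq> ball c \<rho> \<inter> ball y \<rho>"
    using close[OF _ mc(1)] close[OF _ mc(2)] h by (auto simp: dist_norm norm_minus_commute)
  have "unit_ball_vol (real DIM('a)) * R ^ DIM('a) * e / (8 * R) \<le> measure lborel ?T"
    by (rule slab_volume[OF v(1) e(1) eR])
  also have "\<dots> \<le> measure lborel (ball c \<rho> \<inter> ball y \<rho>)"
    using sub by (intro measure_mono_bounded) auto
  also have "unit_ball_vol (real DIM('a)) * R ^ DIM('a) * e / (8 * R) =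
    unit_ball_vol (real DIM('a)) / 8 * (sqrt \<rho> / 2) ^ (DIM('a) - 1) * e powr ((real DIM('a) + 1) / 2)"
  proof -
    obtain k where k: "DIM('a) = Suc k" by (metis DIM_positive gr0_conv_Suc)
    have "e powr ((real DIM('a) + 1) / 2) = e powr (real k / 2) * e powr 1"
      unfolding powr_add[symmetric] k by (simp add: field_simps)
    also have "e powr (real k / 2) = sqrt e ^ k"
      using e by (simp add: powr_half_sqrt[symmetric] powr_power)
    finally have "e powr ((real DIM('a) + 1) / 2) = sqrt e ^ k * e" using e by simp
    moreover have "R ^ DIM('a) * e / (8 * R) = R ^ k * e / 8" using R by (simp add: k)
    moreover have "R ^ k = (sqrt \<rho> / 2) ^ k * sqrt e ^ k" by (simp add: R_def real_sqrt_mult power_mult_distrib[symmetric])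
    moreover have "unit_ball_vol (real DIM('a)) * R ^ DIM('a) * e / (8 * R) =
        unit_ball_vol (real DIM('a)) * (R ^ DIM('a) * e / (8 * R))" by simp
    ultimately have "unit_ball_vol (real DIM('a)) * R ^ DIM('a) * e / (8 * R) =
        unit_ball_vol (real DIM('a)) / 8 * (sqrt \<rho> / 2) ^ k * e powr ((real DIM('a) + 1) / 2)"
      by (simp only: mult.assoc times_divide_eq_left times_divide_eq_right)
    thus ?thesis using k by simp
  qed
  finally show ?thesis .
qed

section \<open>Geometry of the estimator\<close>

text \<open>The pointwise bounds also make the families bounded, so that the real suprema are
  genuine. The absolute value matches the form of \<open>bigO_P\<close>.\<close>

lemma hausdorff_distance_le:
  fixes A B :: "'a::euclidean_space set"
  assumes "A \<noteq> {}" "B \<noteq> {}"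
    and "\<And>a. a \<in> A \<Longrightarrow> infdist a B \<le> e" "\<And>b. b \<in> B \<Longrightarrow> infdist b A \<le> e"
  shows "\<bar>hausdorff_distance A B\<bar> \<le> e"
proof -
  obtain a where a: "a \<in> A" using assms by blast
  have "(SUP a\<in>A. infdist a B) \<le> e" "(SUP b\<in>B. infdist b A) \<le> e"
    using assms by (auto intro: cSUP_least)
  moreover have "0 \<le> (SUP a\<in>A. infdist a B)"
  proof -
    have "bdd_above ((\<lambda>a. infdist a B) ` A)" using assms(3) by (intro bdd_aboveI2)
    hence "infdist a B \<le> (SUP a\<in>A. infdist a B)" using a by (intro cSUP_upper)
    thus ?thesis using infdist_nonneg[of a B] by linarith
  qed
  ultimately show ?thesis by (simp add: hausdorff_distance_def)
qed

context rolling_set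
begin

definition cap_const :: "real \<Rightarrow> real" where
  "cap_const \<rho> = unit_ball_vol (real DIM('a)) / 8 * (sqrt \<rho> / 2) ^ (DIM('a) - 1)"

lemma cap_const_pos: "0 < \<rho> \<Longrightarrow> 0 < cap_const \<rho>"
  by (simp add: cap_const_def)

text \<open>The ball about \<open>y\<close> is shrunk to radius \<rho> with \<open>z\<close> still
  inside. Its center and that of the inner ball of radius \<rho> near \<open>z\<close> are at most
  \<open>2 * \<rho> - e\<close> apart, so \<open>lens_volume\<close> applies.\<close>

lemma cap_volume:
  assumes "0 < e" "e \<le> \<rho>" "\<rho> \<le> l" "\<rho> \<le> g" "ball z e \<subseteq> S" "z \<in> ball y g"
  shows "cap_const \<rho> * e powr ((real DIM('a) + 1) / 2) \<le> measure lborel (S \<inter> ball y g)"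
proof -
  have rho: "0 < \<rho>" using assms by simp
  obtain y' where y': "z \<in> ball y' \<rho>" "ball y' \<rho> \<subseteq> ball y g"
    using smaller_ball_through_point[OF rho assms(4,6)] .
  have "z \<in> S" using assms(1,5) by auto
  then obtain c where c: "ball c \<rho> \<subseteq> S" "dist z c \<le> \<rho> - e"
    using deep_point_in_inner_ball[OF _ assms(5) less_imp_le[OF assms(1)] assms(2) rho assms(3)] by blast
  have "dist c y' \<le> dist z c + dist y' z" using dist_triangle[of c y' z] by (simp add: dist_commute)
  also have "\<dots> \<le> 2 * \<rho> - e" using c y' by simp
  finally have "cap_const \<rho> * e powr ((real DIM('a) + 1) / 2) \<le> measure lborel (ball c \<rho> \<inter> ball y' \<rho>)"
    unfolding cap_const_def by (rule lens_volume[OF assms(1,2)])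
  also have "\<dots> \<le> measure lborel (S \<inter> ball y g)"
    using c y' by (intro measure_mono_bounded sets.Int borel) auto
  finally show ?thesis .
qed

text \<open>Discretization for the union bound: an empty ball of radius \<open>g\<close> containing
  \<open>z\<close> contains the ball of radius \<open>g - e / 4\<close> about a net point. Moving
  \<open>z\<close> by at most \<open>e / 2\<close> towards the center brings it into the smaller
  ball and leaves depth \<open>e / 2\<close>.\<close>

lemma uncovered_deep_point:
  assumes e: "0 < e" "e \<le> g / 2" "g / 2 \<le> l" and R: "S \<subseteq> cball 0 R"
    and G: "cball 0 (R + g) \<subseteq> (\<Union>x\<in>G. cball x (e / 4))"
    and z: "ball z e \<subseteq> S" "z \<notin> r_convex_hull g A"
  obtains x where "x \<in> G" "A \<inter> ball x (g - e / 4) = {}"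
    "cap_const (g / 2) * (e / 2) powr ((real DIM('a) + 1) / 2) \<le> measure lborel (S \<inter> ball x (g - e / 4))"
proof -
  obtain y where y: "ball y g \<inter> A = {}" "z \<in> ball y g" using z(2) by (auto simp: r_convex_hull_def)
  have "z \<in> S" using z e by auto
  hence "norm z \<le> R" using R by auto
  moreover have "norm y \<le> norm z + dist y z" using norm_triangle_sub[of y z] by (simp add: dist_norm)
  ultimately have "y \<in> cball 0 (R + g)" using y(2) by simp
  then obtain x where x: "x \<in> G" "dist x y \<le> e / 4" using G by auto
  have sub: "ball x (g - e / 4) \<subseteq> ball y g" using x by (simp add: ball_subset_ball_iff)
  have g: "g > 0" using e by simp
  \<comment> \<open>Chosen with \<open>k * g = e / 2\<close>: this bounds the move and also brings
    \<open>z'\<close> within \<open>g - e / 2\<close> of \<open>y\<close>, hence within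
    \<open>g - e / 4\<close> of \<open>x\<close>.\<close>
  define k where "k = e / (2 * g)"
  have k: "0 < k" "k < 1" using e g by (auto simp: k_def field_simps)
  define z' where "z' = z + k *\<^sub>R (y - z)"
  have zy: "norm (y - z) < g" using y by (simp add: dist_norm)
  have "dist z z' = k * norm (y - z)" using k by (simp add: z'_def dist_norm)
  also have "\<dots> \<le> k * g" using zy k by (intro mult_left_mono) auto
  also have "\<dots> = e / 2" using g by (simp add: k_def)
  finally have zz: "dist z z' \<le> e / 2" .
  have "y - z' = (1 - k) *\<^sub>R (y - z)" by (simp add: z'_def algebra_simps)
  hence "dist y z' = (1 - k) * norm (y - z)" using k by (simp add: dist_norm)
  also have "\<dots> < (1 - k) * g" using zy k by (intro mult_strict_left_mono) auto
  also have "\<dots> = g - e / 2" using g by (simp add: k_def algebra_simps)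
  finally have zx: "z' \<in> ball x (g - e / 4)" using x dist_triangle[of x z' y] e by simp
  have "ball z' (e / 2) \<subseteq> ball z e" using zz by (simp add: ball_subset_ball_iff dist_commute)
  hence "ball z' (e / 2) \<subseteq> S" using z by blast
  hence "cap_const (g / 2) * (e / 2) powr ((real DIM('a) + 1) / 2) \<le> measure lborel (S \<inter> ball x (g - e / 4))"
    using zx e by (intro cap_volume) auto
  moreover have "A \<inter> ball x (g - e / 4) = {}" using sub y by blast
  ultimately show ?thesis using x that by blast
qed

text \<open>Some interior point \<open>z\<close> of the convex hull lies outside \<open>S\<close>.
  Near \<open>z\<close> a ball of very large radius resembles a half-space, and every half-space
  through \<open>z\<close> contains points of \<open>S\<close> well inside it, so no large ball
  containing \<open>z\<close> is empty.\<close>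

lemma nonconvex_hull_point:
  assumes "\<not> convex S"
  obtains g0 z where "0 < g0" "z \<notin> S" "\<And>g. g0 \<le> g \<Longrightarrow> z \<in> r_convex_hull g S"
proof -
  let ?H = "convex hull S"
  obtain a where "a \<in> frontier S" using frontier_nonempty by blast
  then obtain u0 where "ball (a - l *\<^sub>R u0) l \<subseteq> S" using obtain_normal by metis
  hence "ball (a - l *\<^sub>R u0) l \<subseteq> interior ?H" using hull_subset[of S convex] by (intro interior_maximal) auto
  moreover have "a - l *\<^sub>R u0 \<in> ball (a - l *\<^sub>R u0) l" using l_pos by simp
  ultimately have ne: "interior ?H \<noteq> {}" by blast
  have "\<not> interior ?H \<subseteq> S"
  proof
    assume "interior ?H \<subseteq> S"
    hence "closure (interior ?H) \<subseteq> S" using closed by (rule closure_minimal)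
    hence "closure ?H \<subseteq> S" using convex_closure_interior[OF convex_convex_hull ne] by simp
    hence "?H = S" using closure_subset hull_subset[of S convex] by blast
    thus False using assms by (metis convex_convex_hull)
  qed
  then obtain z where z: "z \<in> interior ?H" "z \<notin> S" by blast
  then obtain \<delta> where \<delta>: "0 < \<delta>" "cball z \<delta> \<subseteq> ?H" by (auto simp: mem_interior_cball)
  obtain D where D: "\<And>s. s \<in> S \<Longrightarrow> dist z s \<le> D" using bounded by (auto simp: bounded_any_center[of _ z])
  obtain s0 where s0: "s0 \<in> S" using nonempty by blast
  have D0: "0 \<le> D" using D[OF s0] zero_le_dist[of z s0] by linarith
  \<comment> \<open>\<open>g > D\<close> makes the ball about \<open>z\<close> itself meet
    \<open>S\<close> and settles the case of small \<open>t\<close> below;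
    \<open>g > D\<^sup>2 / \<delta>\<close> settles the case of large \<open>t\<close>.\<close>
  define g0 where "g0 = D + 1 + D\<^sup>2 / \<delta>"
  have g0: "g0 \<ge> D + 1" using \<delta> by (simp add: g0_def)
  have "z \<in> r_convex_hull g S" if g: "g0 \<le> g" for g
  proof (rule ccontr)
    assume "z \<notin> r_convex_hull g S"
    then obtain y where y: "ball y g \<inter> S = {}" "z \<in> ball y g" by (auto simp: r_convex_hull_def)
    have gD: "D < g" using g g0 by simp
    have "s0 \<in> ball z g" using D[OF s0] gD by simp
    hence "y \<noteq> z" using y(1) s0 by blast
    define t where "t = norm (y - z)"
    define u where "u = (y - z) /\<^sub>R t"
    have t: "0 < t" "t < g" using \<open>y \<noteq> z\<close> y by (auto simp: t_def dist_norm)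
    have u: "norm u = 1" "y = z + t *\<^sub>R u" using t by (auto simp: u_def t_def)
    \<comment> \<open>Otherwise the convex hull would lie in an open half-space with
      \<open>z + \<delta> *\<^sub>R u\<close>, a point of the hull, on its boundary.\<close>
    have "\<exists>s\<in>S. \<delta> \<le> u \<bullet> (s - z)"
    proof (rule ccontr)
      assume "\<not> ?thesis"
      hence "S \<subseteq> {x. u \<bullet> x < \<delta> + u \<bullet> z}" by (auto simp: inner_diff_right not_le algebra_simps)
      hence "?H \<subseteq> {x. u \<bullet> x < \<delta> + u \<bullet> z}" by (intro hull_minimal convex_halfspace_lt)
      moreover have "z + \<delta> *\<^sub>R u \<in> ?H" using \<delta> u by (auto simp: dist_norm subset_eq)
      ultimately show False using u by (auto simp: inner_add_right norm_eq_1)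
    qed
    then obtain s where s: "s \<in> S" "\<delta> \<le> u \<bullet> (s - z)" by blast
    have sz: "(norm (s - z))\<^sup>2 \<le> D\<^sup>2" using D[OF s(1)] by (intro power_mono) (auto simp: dist_norm norm_minus_commute)
    have expand: "(norm (w - t *\<^sub>R u))\<^sup>2 = (norm w)\<^sup>2 - 2 * t * (u \<bullet> w) + t * t" for w
      unfolding power2_norm_eq_inner using u(1)
      by (simp add: norm_eq_1 inner_diff_left inner_diff_right inner_commute[of w u] algebra_simps)
    have "s - y = (s - z) - t *\<^sub>R u" unfolding u(2) by simp
    hence "(norm (s - y))\<^sup>2 = (norm (s - z))\<^sup>2 - 2 * t * (u \<bullet> (s - z)) + t * t"
      by (simp only: expand)
    also have "\<dots> \<le> D\<^sup>2 - 2 * t * \<delta> + t * t"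
      using sz mult_left_mono[OF s(2), of "2 * t"] t by linarith
    also have "\<dots> < g\<^sup>2"
    proof (cases "t \<le> 2 * \<delta>")
      case True
      hence "t * t \<le> t * (2 * \<delta>)" using t by (intro mult_left_mono) auto
      moreover have "D\<^sup>2 < g\<^sup>2" using gD D0 by (intro power_strict_mono) auto
      ultimately show ?thesis by (simp add: algebra_simps)
    next
      case False
      hence "t * (t - 2 * \<delta>) \<le> g * (g - 2 * \<delta>)" using t \<delta> by (intro mult_mono) auto
      hence "t * t - 2 * t * \<delta> \<le> g\<^sup>2 - 2 * (g * \<delta>)" by (simp add: power2_eq_square algebra_simps)
      moreover have "D\<^sup>2 < 2 * (g * \<delta>)"
      proof -
        have "D\<^sup>2 / \<delta> < g" using g D0 by (simp add: g0_def)
        hence "D\<^sup>2 < g * \<delta>" using \<delta> by (simp add: pos_divide_less_eq)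
        moreover have "0 < g * \<delta>" using t \<delta> by simp
        ultimately show ?thesis by linarith
      qed
      ultimately show ?thesis by linarith
    qed
    finally have "norm (s - y) < g" using t by (intro power2_less_imp_less[of "norm (s - y)"]) auto
    hence "s \<in> ball y g" by (simp add: dist_norm norm_minus_commute)
    thus False using y(1) s(1) by blast
  qed
  thus ?thesis using that[of g0 z] z g0 D0 by auto
qed

text \<open>The supremum of the radii at which \<open>S\<close> is its own hull is finite by
  \<open>nonconvex_hull_point\<close>, and monotonicity in the radius fills in everything below it.
  Nothing is claimed at \<open>r0\<close> itself.\<close>

lemma reach_radius:
  assumes "\<not> convex S"
  obtains r0 where "r \<le> r0" "\<And>g. 0 < g \<Longrightarrow> g < r0 \<Longrightarrow> r_convex_hull g S = S"
    "\<And>g. r0 < g \<Longrightarrow> r_convex_hull g S \<noteq> S"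
proof -
  define T where "T = {g. 0 < g \<and> r_convex_hull g S = S}"
  have rT: "r \<in> T" using r_pos r_convex_hull_self by (simp add: T_def)
  obtain g0 z where g0: "0 < g0" "z \<notin> S" "\<And>g. g0 \<le> g \<Longrightarrow> z \<in> r_convex_hull g S"
    using nonconvex_hull_point[OF assms] by metis
  have bdd: "bdd_above T"
  proof (rule bdd_aboveI)
    fix g assume "g \<in> T"
    hence "\<not> g0 \<le> g" using g0(2,3) by (auto simp: T_def)
    thus "g \<le> g0" by simp
  qed
  show ?thesis
  proof (rule that)
    show "r \<le> Sup T" using rT bdd by (rule cSup_upper)
    show "r_convex_hull g S = S" if g: "0 < g" "g < Sup T" for g
    proof -
      obtain g' where g': "g' \<in> T" "g < g'" using g rT less_cSupE[of g T] by blast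
      hence "r_convex_hull g S \<subseteq> S" using r_convex_hull_mono_radius[of g g' S] g by (auto simp: T_def)
      thus ?thesis using r_convex_hull_superset by blast
    qed
    show "r_convex_hull g S \<noteq> S" if g: "Sup T < g" for g
    proof
      assume "r_convex_hull g S = S"
      moreover have "0 < g" using \<open>r \<le> Sup T\<close> r_pos g by linarith
      ultimately have "g \<in> T" by (simp add: T_def)
      hence "g \<le> Sup T" using bdd by (rule cSup_upper)
      thus False using g by simp
    qed
  qed
qed

text \<open>If a ball of radius \<open>g\<close> misses the sample and comes close to \<open>z\<close>, a ball of the smaller radius \<open>g'\<close>
  tangent to it from inside, moved slightly so as to contain \<open>z\<close>, sticks out only in a small
  neighbourhood of \<open>z\<close>, which is disjoint from \<open>S\<close>. It would then miss \<open>S\<close>.\<close>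

lemma hull_gap:
  assumes g: "0 < g'" "g' < g" and z: "z \<in> r_convex_hull g' S" "z \<notin> S"
  obtains k where "0 < k"
    "\<And>A. A \<subseteq> S \<Longrightarrow> (\<And>s. s \<in> S \<Longrightarrow> \<exists>a\<in>A. dist s a < k) \<Longrightarrow> cball z k \<subseteq> r_convex_hull g A - S"
proof -
  have "open (- S)" using closed by (simp add: open_Compl)
  then obtain \<theta> where \<theta>: "0 < \<theta>" "ball z \<theta> \<subseteq> - S" using z(2) by (meson ComplI openE)
  \<comment> \<open>\<open>f k < 0\<close> is the inequality needed at the end, with all errors due
    to \<open>k\<close> collected. As \<open>k\<close> tends to \<open>0\<close>, \<open>f k\<close>
    tends to \<open>\<theta>\<^sup>2 * (1 - g / g')\<close>, which is negative because
    \<open>g' < g\<close>.\<close>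
  define f where "f k = \<theta>\<^sup>2 * (1 - (g - k) / g') + 2 * g' * k * ((g + k) / (g' - k)) + (g + k)\<^sup>2 - (g - k)\<^sup>2" for k
  have "(f \<longlongrightarrow> \<theta>\<^sup>2 * (1 - (g - 0) / g') + 2 * g' * 0 * ((g + 0) / (g' - 0)) + (g + 0)\<^sup>2 - (g - 0)\<^sup>2) (at_right 0)"
    unfolding f_def using g by (intro tendsto_intros) auto
  moreover have "\<theta>\<^sup>2 * (1 - (g - 0) / g') + 2 * g' * 0 * ((g + 0) / (g' - 0)) + (g + 0)\<^sup>2 - (g - 0)\<^sup>2 < 0"
    using g \<theta> by (simp add: mult_pos_neg)
  ultimately have "eventually (\<lambda>k. f k < 0) (at_right 0)" by (rule order_tendstoD)
  moreover have "eventually (\<lambda>k. k < min \<theta> (min g' (g - g'))) (at_right 0)"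
    using g \<theta> by (intro eventually_at_right_less[THEN eventually_mono] order_tendstoD(2)[OF tendsto_ident_at]) auto
  moreover have "eventually (\<lambda>k::real. 0 < k) (at_right 0)" by (rule eventually_at_right_less)
  ultimately have "eventually (\<lambda>k. f k < 0 \<and> k < min \<theta> (min g' (g - g')) \<and> 0 < k) (at_right 0)"
    by (intro eventually_conj)
  then obtain k where k: "f k < 0" "k < \<theta>" "k < g'" "k < g - g'" "0 < k"
    using eventually_happens'[OF trivial_limit_at_right_real] by force
  have "z' \<in> r_convex_hull g A" if A: "A \<subseteq> S" "\<And>s. s \<in> S \<Longrightarrow> \<exists>a\<in>A. dist s a < k" and z': "dist z z' \<le> k" for A z'
  proof (rule ccontr)
    assume "z' \<notin> r_convex_hull g A"
    then obtain y where y: "ball y g \<inter> A = {}" "dist y z' < g" by (auto simp: r_convex_hull_def)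
    \<comment> \<open>\<open>A\<close> is \<open>k\<close>-dense in \<open>S\<close>, so shrinking
      the empty ball by \<open>k\<close> makes it miss all of \<open>S\<close>.\<close>
    have miss: "g - k \<le> dist y s" if s: "s \<in> S" for s
    proof -
      obtain a where a: "a \<in> A" "dist s a < k" using A(2)[OF s] by blast
      hence "a \<notin> ball y g" using y(1) by blast
      thus ?thesis using a dist_triangle[of y a s] by simp
    qed
    define t where "t = dist z y"
    have tk: "t < g + k" using y z' dist_triangle[of z y z'] by (simp add: t_def dist_commute)
    show False
    proof (cases "t < g - k")
      case True
      have "z \<in> r_convex_hull (g - k) S" using z(1) r_convex_hull_mono_radius[of g' "g - k" S] g k by auto
      moreover have "ball y (g - k) \<inter> S = {}" using miss by fastforce
      moreover have "z \<in> ball y (g - k)" using True by (simp add: t_def dist_commute)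
      ultimately show False by (auto simp: r_convex_hull_def)
    next
      case False
      have t0: "0 < t" using False k g by simp
      define v where "v = (z - y) /\<^sub>R t"
      have v: "norm v = 1" "z - y = t *\<^sub>R v" using t0 by (auto simp: v_def t_def dist_norm)
      \<comment> \<open>The ball of radius \<open>g'\<close> about \<open>z - h *\<^sub>R v\<close>
        contains \<open>z\<close> with margin \<open>k\<close>, so it meets \<open>S\<close> in a
        point \<open>p\<close>, at distance at least \<theta> from \<open>z\<close>.\<close>
      define h where "h = g' - k"
      have h: "0 < h" using k by (simp add: h_def)
      have "dist (z - h *\<^sub>R v) z = h" using v h by (simp add: dist_norm)
      hence "z \<in> ball (z - h *\<^sub>R v) g'" using k by (simp add: h_def)
      hence "ball (z - h *\<^sub>R v) g' \<inter> S \<noteq> {}" using z(1) by (auto simp: r_convex_hull_def)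
      then obtain p where p: "p \<in> S" "dist (z - h *\<^sub>R v) p < g'" by auto
      define q where "q = p - z"
      define N where "N = (norm q)\<^sup>2"
      define D where "D = q \<bullet> v"
      have sq: "(norm (q + c *\<^sub>R v))\<^sup>2 = N + 2 * c * D + c\<^sup>2" for c
        unfolding N_def D_def power2_norm_eq_inner using v(1)
        by (simp add: norm_eq_1 inner_add_left inner_add_right inner_commute[of v q] power2_eq_square distrib_left)
      have "p \<notin> ball z \<theta>" using p \<theta> by blast
      hence "\<theta> \<le> norm q" by (simp add: q_def dist_norm norm_minus_commute)
      hence N: "\<theta>\<^sup>2 \<le> N" unfolding N_def using \<theta> by (intro power_mono) auto
      have "norm (q + h *\<^sub>R v) < g'" using p(2) by (simp add: q_def dist_norm norm_minus_commute algebra_simps)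
      hence "(norm (q + h *\<^sub>R v))\<^sup>2 < g'\<^sup>2" by (intro power_strict_mono) auto
      hence "2 * h * D < g'\<^sup>2 - h\<^sup>2 - N" unfolding sq by simp
      also have "g'\<^sup>2 - h\<^sup>2 \<le> 2 * g' * k" by (simp add: h_def power2_eq_square algebra_simps)
      finally have hD: "2 * h * D \<le> 2 * g' * k - N" by simp
      \<comment> \<open>Multiplying the bound on \<open>2 * h * D\<close> by \<tau> passes from the
        small ball to the one about \<open>y\<close>. Since \<tau> is at least
        \<open>(g - k) / g' > 1\<close>, the term \<open>N * (1 - \<tau>)\<close> is negative and
        outweighs the errors.\<close>
      define \<tau> where "\<tau> = t / h"
      have \<tau>: "0 < \<tau>" "\<tau> \<le> (g + k) / (g' - k)" "(g - k) / g' \<le> \<tau>"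
        using t0 h tk False g k by (auto simp: \<tau>_def h_def intro!: divide_right_mono frac_le)
      have \<tau>1: "1 \<le> (g - k) / g'" using g k by simp
      have "2 * t * D = \<tau> * (2 * h * D)" using h by (simp add: \<tau>_def)
      also have "\<dots> \<le> \<tau> * (2 * g' * k - N)" using hD \<tau> by (intro mult_left_mono) auto
      finally have "N + 2 * t * D + t\<^sup>2 \<le> N * (1 - \<tau>) + 2 * g' * k * \<tau> + t\<^sup>2" by (simp add: algebra_simps)
      also have "N * (1 - \<tau>) \<le> N * (1 - (g - k) / g')"
        using \<tau> by (intro mult_left_mono) (auto simp: N_def)
      also have "N * (1 - (g - k) / g') \<le> \<theta>\<^sup>2 * (1 - (g - k) / g')"
        using \<tau>1 N by (intro mult_right_mono_neg) auto
      also have "2 * g' * k * \<tau> \<le> 2 * g' * k * ((g + k) / (g' - k))"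
        using \<tau> g k by (intro mult_left_mono) auto
      also have "t\<^sup>2 \<le> (g + k)\<^sup>2" using tk t0 by (intro power_mono) auto
      also have "\<theta>\<^sup>2 * (1 - (g - k) / g') + 2 * g' * k * ((g + k) / (g' - k)) + (g + k)\<^sup>2 < (g - k)\<^sup>2"
        using k(1) by (simp add: f_def)
      finally have "(norm (q + t *\<^sub>R v))\<^sup>2 < (g - k)\<^sup>2" unfolding sq by simp
      hence "norm (q + t *\<^sub>R v) < g - k" using g k by (intro power2_less_imp_less[of "norm (q + t *\<^sub>R v)"]) auto
      moreover have "q + t *\<^sub>R v = p - y" using v(2) by (simp add: q_def algebra_simps)
      ultimately have "dist y p < g - k" by (simp add: dist_norm norm_minus_commute)
      thus False using miss[OF p(1)] by simp
    qed
  qed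
  moreover have "cball z k \<inter> S = {}"
  proof -
    have "cball z k \<subseteq> ball z \<theta>" using k(2) by auto
    thus ?thesis using \<theta>(2) by blast
  qed
  ultimately show ?thesis using k(5) by (intro that[of k]) (auto simp: subset_eq disjoint_iff)
qed

text \<open>By \<open>deep_point_in_inner_ball\<close> at depth \<open>0\<close>, \<open>s\<close>
  is within \<rho> of the center of a ball of radius \<rho> in \<open>S\<close>, and this ball
  contains a point of \<open>A\<close>.\<close>

lemma dense_if_meets_balls:
  assumes "0 < \<rho>" "\<rho> \<le> l" "\<And>x. cball x \<rho> \<subseteq> S \<Longrightarrow> A \<inter> cball x \<rho> \<noteq> {}" "s \<in> S"
  obtains a where "a \<in> A" "dist s a \<le> 2 * \<rho>"
proof -
  obtain c where c: "ball c \<rho> \<subseteq> S" "dist s c \<le> \<rho>"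
    using deep_point_in_inner_ball[of s 0 \<rho>] assms by auto
  have "cball c \<rho> \<subseteq> S" using closure_minimal[OF c(1) closed] assms(1) by simp
  then obtain a where a: "a \<in> A" "dist c a \<le> \<rho>" using assms(3)[of c] by auto
  have "dist s a \<le> dist s c + dist c a" by (rule dist_triangle)
  thus ?thesis using a c that by force
qed

text \<open>Inner balls of radius \<open>e\<close> put every point of \<open>S\<close> within
  \<open>e\<close> of the erosion. A segment from a frontier point of \<open>S\<close> to a nearby
  point of \<open>C\<close> crosses the frontier of \<open>C\<close>. Conversely, a frontier point
  of \<open>C\<close> cannot have depth \<open>2 * e\<close> in \<open>S\<close>, as its
  \<open>e\<close>-ball would then lie in the erosion and so in \<open>C\<close>.\<close>

lemma distances_from_erosion:
  assumes e: "0 < e" "e \<le> l" and C: "erosion e S \<subseteq> C" "C \<subseteq> S" "closed C"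
  shows "\<bar>hausdorff_distance S C\<bar> \<le> e"
    and "\<bar>hausdorff_distance (frontier S) (frontier C)\<bar> \<le> 2 * e"
    and "\<bar>measure_distance S C\<bar> \<le> measure lborel (S - erosion e S)"
proof -
  have near: "\<exists>c\<in>C. dist z c \<le> e" if z: "z \<in> S" for z
  proof -
    obtain c where "ball c e \<subseteq> S" "dist z c \<le> e"
      using deep_point_in_inner_ball[of z 0 e] z e by auto
    thus ?thesis using C by (auto simp: erosion_def)
  qed
  hence Cne: "C \<noteq> {}" using nonempty by blast
  show "\<bar>hausdorff_distance S C\<bar> \<le> e"
  proof (rule hausdorff_distance_le[OF nonempty Cne])
    fix a assume "a \<in> S"
    then obtain c where "c \<in> C" "dist a c \<le> e" using near by blast
    thus "infdist a C \<le> e" using infdist_le[of c C a] by linarith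
  next
    fix b assume "b \<in> C"
    hence "infdist b S = 0" using C(2) by (intro infdist_zero) auto
    thus "infdist b S \<le> e" using e by simp
  qed
  have CU: "C \<noteq> UNIV" using C(2) not_UNIV by blast
  show "\<bar>hausdorff_distance (frontier S) (frontier C)\<bar> \<le> 2 * e"
  proof (rule hausdorff_distance_le[OF frontier_nonempty])
    show "frontier C \<noteq> {}" using Cne CU frontier_eq_empty by blast
  next
    fix a assume a: "a \<in> frontier S"
    obtain c where c: "c \<in> C" "dist a c \<le> e" using near a frontier_subset by blast
    have "\<exists>b\<in>frontier C. dist a b \<le> e"
    proof (cases "a \<in> C")
      case True
      moreover have "a \<notin> interior C" using a interior_mono[OF C(2)] by (auto simp: frontier_def)
      ultimately have "a \<in> frontier C" using closure_subset by (auto simp: frontier_def)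
      thus ?thesis using e by force
    next
      case False
      have "closed_segment a c \<inter> frontier C \<noteq> {}"
        using False c by (intro connected_Int_frontier) auto
      then obtain b where b: "b \<in> frontier C" "b \<in> closed_segment a c" by blast
      have "dist a b \<le> dist a c" using segment_bound(1)[OF b(2)] by (simp add: dist_norm norm_minus_commute)
      also have "\<dots> \<le> e" by (rule c(2))
      finally show ?thesis using b(1) by blast
    qed
    then obtain b where "b \<in> frontier C" "dist a b \<le> e" by blast
    thus "infdist a (frontier C) \<le> 2 * e" using infdist_le[of b "frontier C" a] e by linarith
  next
    fix b assume b: "b \<in> frontier C"
    hence "b \<in> S" using C frontier_subset_closed by blast
    have "\<not> ball b (2 * e) \<subseteq> S"
    proof
      assume bS: "ball b (2 * e) \<subseteq> S"
      have "ball b e \<subseteq> erosion e S"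
      proof
        fix w assume "w \<in> ball b e"
        hence "ball w e \<subseteq> ball b (2 * e)" by (simp add: ball_subset_ball_iff dist_commute)
        thus "w \<in> erosion e S" using bS by (auto simp: erosion_def)
      qed
      hence "ball b e \<subseteq> interior C" using C by (intro interior_maximal) auto
      moreover have "b \<in> ball b e" using e by simp
      ultimately have "b \<in> interior C" by (rule subsetD)
      thus False using b by (simp add: frontier_def)
    qed
    then obtain a where "a \<in> frontier S" "dist b a < 2 * e" using ball_subset_frontier[OF \<open>b \<in> S\<close>] by metis
    thus "infdist b (frontier S) \<le> 2 * e" using infdist_le[of a "frontier S" b] by linarith
  qed
  have "measure_distance S C \<le> measure lborel (S - erosion e S)"
    unfolding measure_distance_def
  proof (rule measure_mono_bounded)
    show "sym_diff S C \<in> sets borel"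
      by (intro sets.Un sets.Diff borel borel_closed[OF C(3)])
    show "S - erosion e S \<in> sets borel"
      by (intro sets.Diff borel borel_closed[OF closed_erosion])
    show "bounded (S - erosion e S)" using bounded by (rule bounded_subset) auto
  qed (use C in auto)
  thus "\<bar>measure_distance S C\<bar> \<le> measure lborel (S - erosion e S)"
    by (simp add: measure_distance_def)
qed

end

section \<open>Random samples\<close>

locale uniform_sample = rolling_set S r l + prob_space M
  for S :: "'a::euclidean_space set" and r l :: real and M :: "'b measure" +
  fixes X :: "nat \<Rightarrow> 'b \<Rightarrow> 'a"
  assumes indep: "indep_vars (\<lambda>_. borel) X {1..}"
    and uniform: "\<And>i. 1 \<le> i \<Longrightarrow> distr M borel (X i) = uniform_measure lborel S"
begin

definition sample :: "nat \<Rightarrow> 'b \<Rightarrow> 'a set" where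
  "sample n \<omega> = (\<lambda>i. X i \<omega>) ` {1..n}"

lemma finite_sample: "finite (sample n \<omega>)" by (simp add: sample_def)

lemma sample_measurable: "1 \<le> i \<Longrightarrow> X i \<in> borel_measurable M"
  using indep by (auto simp: indep_vars_def)

lemma prob_X:
  assumes "1 \<le> i" "B \<in> sets borel"
  shows "prob (X i -` B \<inter> space M) = measure lborel (S \<inter> B) / measure lborel S"
proof -
  have "emeasure lborel S \<noteq> \<infinity>" using emeasure_bounded_finite[OF bounded] by auto
  moreover have "emeasure lborel S \<noteq> 0" using measure_pos by (auto simp: measure_def)
  ultimately have "measure (uniform_measure lborel S) B = measure lborel (S \<inter> B) / measure lborel S"
    using assms by (intro measure_uniform_measure) auto
  thus ?thesis using measure_distr[of "X i" M borel B] assms uniform[OF assms(1)] sample_measurable by auto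
qed

text \<open>Independence gives \<open>(1 - p) ^ n\<close>, where \<open>p\<close> is the proportion
  of \<open>S\<close> in \<open>B\<close>, and \<open>1 - p \<le> exp (- p)\<close>.\<close>

lemma prob_sample_misses:
  assumes "1 \<le> n" "B \<in> sets borel"
  shows "{\<omega> \<in> space M. sample n \<omega> \<inter> B = {}} \<in> events"
    and "prob {\<omega> \<in> space M. sample n \<omega> \<inter> B = {}} \<le> exp (- real n * measure lborel (S \<inter> B) / measure lborel S)"
proof -
  let ?p = "measure lborel (S \<inter> B) / measure lborel S"
  have B: "- B \<in> sets borel" using assms(2) by auto
  have eq: "{\<omega> \<in> space M. sample n \<omega> \<inter> B = {}} = (\<Inter>i\<in>{1..n}. X i -` (- B) \<inter> space M)"
    using assms(1) by (fastforce simp: sample_def)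
  show "{\<omega> \<in> space M. sample n \<omega> \<inter> B = {}} \<in> events"
    unfolding eq using assms B by (intro sets.finite_INT measurable_sets[OF sample_measurable]) auto
  have "prob {\<omega> \<in> space M. sample n \<omega> \<inter> B = {}} = (\<Prod>i\<in>{1..n}. prob (X i -` (- B) \<inter> space M))"
    unfolding eq using assms B by (intro indep_varsD[OF indep]) auto
  also have "\<dots> = (\<Prod>i\<in>{1..n}. 1 - ?p)"
  proof (rule prod.cong)
    fix i assume i: "i \<in> {1..n}"
    have "measure lborel S = measure lborel (S \<inter> B) + measure lborel (S \<inter> - B)"
    proof -
      have "S \<inter> B \<in> fmeasurable lborel" "S \<inter> - B \<in> fmeasurable lborel"
        using borel bounded assms(2) B by (auto intro!: borel_bounded_fmeasurable intro: bounded_subset)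
      hence "measure lborel ((S \<inter> B) \<union> (S \<inter> - B)) = measure lborel (S \<inter> B) + measure lborel (S \<inter> - B)"
        by (intro measure_Un3[THEN trans]) auto
      moreover have "(S \<inter> B) \<union> (S \<inter> - B) = S" by auto
      ultimately show ?thesis by simp
    qed
    hence "measure lborel (S \<inter> - B) / measure lborel S = 1 - ?p" using measure_pos by (simp add: field_simps)
    thus "prob (X i -` (- B) \<inter> space M) = 1 - ?p" using i B by (simp add: prob_X)
  qed simp
  also have "\<dots> = (1 - ?p) ^ n" by simp
  also have "\<dots> \<le> exp (- ?p) ^ n"
  proof (rule power_mono)
    show "1 - ?p \<le> exp (- ?p)" using exp_ge_add_one_self[of "- ?p"] by simp
    have "measure lborel (S \<inter> B) \<le> measure lborel S"
      using borel bounded assms(2) by (intro measure_mono_bounded) auto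
    thus "0 \<le> 1 - ?p" using measure_pos by simp
  qed
  also have "\<dots> = exp (- real n * measure lborel (S \<inter> B) / measure lborel S)"
    by (simp add: exp_of_nat_mult[symmetric])
  finally show "prob {\<omega> \<in> space M. sample n \<omega> \<inter> B = {}} \<le> exp (- real n * measure lborel (S \<inter> B) / measure lborel S)" .
qed

text \<open>Union bound. The exceptional set is returned as an event, so that all geometry can be
  done pointwise off \<open>E\<close>.\<close>

lemma prob_sample_misses_some:
  assumes n: "1 \<le> n" and G: "finite G" "\<And>x. x \<in> G \<Longrightarrow> B x \<in> sets borel"
    "\<And>x. x \<in> G \<Longrightarrow> c \<le> measure lborel (S \<inter> B x)"
  obtains E where "E \<in> events" "prob E \<le> real (card G) * exp (- real n * c / measure lborel S)"
    "\<And>\<omega> x. \<omega> \<in> space M - E \<Longrightarrow> x \<in> G \<Longrightarrow> sample n \<omega> \<inter> B x \<noteq> {}"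
proof -
  define F where "F x = {\<omega> \<in> space M. sample n \<omega> \<inter> B x = {}}" for x
  have F: "F x \<in> events" if "x \<in> G" for x unfolding F_def using n G that by (intro prob_sample_misses) auto
  have "prob (\<Union>x\<in>G. F x) \<le> (\<Sum>x\<in>G. prob (F x))" using G F by (intro measure_UNION_le) auto
  also have "\<dots> \<le> (\<Sum>x\<in>G. exp (- real n * c / measure lborel S))"
  proof (rule sum_mono)
    fix x assume x: "x \<in> G"
    have "prob (F x) \<le> exp (- real n * measure lborel (S \<inter> B x) / measure lborel S)"
      unfolding F_def using n G x by (intro prob_sample_misses) auto
    also have "\<dots> \<le> exp (- real n * c / measure lborel S)"
      using G(3)[OF x] measure_pos by (simp add: divide_right_mono mult_left_mono)
    finally show "prob (F x) \<le> exp (- real n * c / measure lborel S)" .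
  qed
  also have "\<dots> = real (card G) * exp (- real n * c / measure lborel S)" by simp
  finally show ?thesis using F G by (intro that[of "\<Union>x\<in>G. F x"]) (auto simp: F_def)
qed

lemma sample_subset_ae:
  obtains E where "E \<in> events" "prob E = 0" "\<And>\<omega>. \<omega> \<in> space M - E \<Longrightarrow> sample n \<omega> \<subseteq> S"
proof -
  define F where "F i = X i -` (- S) \<inter> space M" for i
  have S: "- S \<in> sets borel" using borel by auto
  have F: "F i \<in> events" "prob (F i) = 0" if "1 \<le> i" for i
    using that S by (auto simp: F_def prob_X intro: measurable_sets[OF sample_measurable])
  have "prob (\<Union>i\<in>{1..n}. F i) \<le> (\<Sum>i\<in>{1..n}. prob (F i))" using F by (intro measure_UNION_le) auto
  also have "\<dots> = 0" using F by simp
  finally have "prob (\<Union>i\<in>{1..n}. F i) = 0" by (simp add: measure_le_0_iff)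
  moreover have "(\<Union>i\<in>{1..n}. F i) \<in> events" using F by (intro sets.finite_UN) auto
  ultimately show ?thesis by (intro that[of "\<Union>i\<in>{1..n}. F i"]) (auto simp: F_def sample_def)
qed

lemma erosion_covered_event:
  assumes n: "1 \<le> n" and e: "0 < e" "e \<le> g / 2" "g / 2 \<le> l" and R: "S \<subseteq> cball 0 R" "0 \<le> R"
  obtains E where "E \<in> events"
    "prob E \<le> (8 * (R + g) / e + 1) ^ DIM('a) *
      exp (- real n * (cap_const (g / 2) * (e / 2) powr ((real DIM('a) + 1) / 2)) / measure lborel S)"
    "\<And>\<omega>. \<omega> \<in> space M - E \<Longrightarrow> erosion e S \<subseteq> r_convex_hull g (sample n \<omega>)"
proof -
  let ?c = "cap_const (g / 2) * (e / 2) powr ((real DIM('a) + 1) / 2)"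
  have pos: "0 < e / 4" "0 \<le> R + g" using e R by auto
  obtain G :: "'a set" where G: "finite G" "cball 0 (R + g) \<subseteq> (\<Union>x\<in>G. cball x (e / 4))"
    "real (card G) \<le> ((2 * (R + g) + e / 4) / (e / 4)) ^ DIM('a)"
    using exists_finite_net[OF pos] by blast
  \<comment> \<open>Net points whose ball catches too little of \<open>S\<close> are dropped from
    the union bound; \<open>uncovered_deep_point\<close> never produces them.\<close>
  define H where "H = {x \<in> G. ?c \<le> measure lborel (S \<inter> ball x (g - e / 4))}"
  have H: "finite H" "\<And>x. x \<in> H \<Longrightarrow> ball x (g - e / 4) \<in> sets borel"
    "\<And>x. x \<in> H \<Longrightarrow> ?c \<le> measure lborel (S \<inter> ball x (g - e / 4))"
    using G(1) by (simp_all add: H_def)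
  obtain E where E: "E \<in> events" "prob E \<le> real (card H) * exp (- real n * ?c / measure lborel S)"
    "\<And>\<omega> x. \<omega> \<in> space M - E \<Longrightarrow> x \<in> H \<Longrightarrow> sample n \<omega> \<inter> ball x (g - e / 4) \<noteq> {}"
    using prob_sample_misses_some[where B = "\<lambda>x. ball x (g - e / 4)", OF n H] by blast
  have "real (card H) \<le> real (card G)" using G(1) by (auto simp: H_def intro: card_mono)
  also have "\<dots> \<le> (8 * (R + g) / e + 1) ^ DIM('a)"
  proof -
    have "(2 * (R + g) + e / 4) / (e / 4) = 8 * (R + g) / e + 1" using e by (simp add: field_simps)
    thus ?thesis using G(3) by simp
  qed
  finally have "real (card H) * exp (- real n * ?c / measure lborel S) \<le>
      (8 * (R + g) / e + 1) ^ DIM('a) * exp (- real n * ?c / measure lborel S)"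
    by (intro mult_right_mono) auto
  moreover have "erosion e S \<subseteq> r_convex_hull g (sample n \<omega>)" if \<omega>: "\<omega> \<in> space M - E" for \<omega>
  proof
    fix z assume z: "z \<in> erosion e S"
    show "z \<in> r_convex_hull g (sample n \<omega>)"
    proof (rule ccontr)
      assume nz: "z \<notin> r_convex_hull g (sample n \<omega>)"
      obtain x where "x \<in> G" "sample n \<omega> \<inter> ball x (g - e / 4) = {}" "?c \<le> measure lborel (S \<inter> ball x (g - e / 4))"
        using uncovered_deep_point[OF e R(1) G(2) _ nz] z by (auto simp: erosion_def)
      thus False using E(3)[OF \<omega>, of x] by (auto simp: H_def)
    qed
  qed
  ultimately show ?thesis using that[OF E(1) order_trans[OF E(2)]] by blast
qed

text \<open>\<open>cball x \<rho>\<close> contains the ball of radius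
  \<open>\<rho> - \<delta>\<close> about some net point, so it suffices to hit those. The loss in
  the radius is traded against the size of the net.\<close>

lemma balls_hit_event:
  assumes n: "1 \<le> n" and \<delta>: "0 < \<delta>" "\<delta> < \<rho>" and R: "S \<subseteq> cball 0 R" "0 \<le> R"
  obtains E where "E \<in> events"
    "prob E \<le> ((2 * R + \<delta>) / \<delta>) ^ DIM('a) *
      exp (- real n * (unit_ball_vol (real DIM('a)) * (\<rho> - \<delta>) ^ DIM('a)) / measure lborel S)"
    "\<And>\<omega> x. \<omega> \<in> space M - E \<Longrightarrow> cball x \<rho> \<subseteq> S \<Longrightarrow> sample n \<omega> \<inter> cball x \<rho> \<noteq> {}"
proof -
  let ?c = "unit_ball_vol (real DIM('a)) * (\<rho> - \<delta>) ^ DIM('a)"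
  obtain G :: "'a set" where G: "finite G" "cball 0 R \<subseteq> (\<Union>x\<in>G. cball x \<delta>)"
    "real (card G) \<le> ((2 * R + \<delta>) / \<delta>) ^ DIM('a)"
    using exists_finite_net[OF \<delta>(1) R(2)] by blast
  define H where "H = {x \<in> G. ?c \<le> measure lborel (S \<inter> ball x (\<rho> - \<delta>))}"
  have H: "finite H" "\<And>x. x \<in> H \<Longrightarrow> ball x (\<rho> - \<delta>) \<in> sets borel"
    "\<And>x. x \<in> H \<Longrightarrow> ?c \<le> measure lborel (S \<inter> ball x (\<rho> - \<delta>))"
    using G(1) by (simp_all add: H_def)
  obtain E where E: "E \<in> events" "prob E \<le> real (card H) * exp (- real n * ?c / measure lborel S)"
    "\<And>\<omega> x. \<omega> \<in> space M - E \<Longrightarrow> x \<in> H \<Longrightarrow> sample n \<omega> \<inter> ball x (\<rho> - \<delta>) \<noteq> {}"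
    using prob_sample_misses_some[where B = "\<lambda>x. ball x (\<rho> - \<delta>)", OF n H] by blast
  have "real (card H) \<le> real (card G)" using G(1) by (auto simp: H_def intro: card_mono)
  also note G(3)
  finally have "real (card H) * exp (- real n * ?c / measure lborel S) \<le>
      ((2 * R + \<delta>) / \<delta>) ^ DIM('a) * exp (- real n * ?c / measure lborel S)"
    by (intro mult_right_mono) auto
  moreover have "sample n \<omega> \<inter> cball x \<rho> \<noteq> {}" if \<omega>: "\<omega> \<in> space M - E" and x: "cball x \<rho> \<subseteq> S" for \<omega> x
  proof -
    have "x \<in> cball 0 R" using x \<delta> R by force
    then obtain y where y: "y \<in> G" "dist y x \<le> \<delta>" using G(2) by auto
    have sub: "ball y (\<rho> - \<delta>) \<subseteq> cball x \<rho>"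
      using y ball_subset_ball_iff[of y "\<rho> - \<delta>" x \<rho>] ball_subset_cball[of x \<rho>] by (auto simp: dist_commute)
    hence "S \<inter> ball y (\<rho> - \<delta>) = ball y (\<rho> - \<delta>)" using x by blast
    hence "y \<in> H" using y \<delta> by (simp add: H_def content_ball)
    thus ?thesis using E(3)[OF \<omega>, of y] sub by blast
  qed
  ultimately show ?thesis using that[OF E(1) order_trans[OF E(2)]] by blast
qed

end

section \<open>Critical values\<close>

lemma gumbel_quantile_le:
  assumes "0 < a" "a < 1"
  shows "gumbel_quantile a \<le> - ln a"
proof -
  have "a \<le> - ln (1 - a)" using ln_le_minus_one[of "1 - a"] assms by simp
  hence "ln a \<le> ln (- ln (1 - a))" using assms by simp
  thus ?thesis by (simp add: gumbel_quantile_def)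
qed

text \<open>Here the convergence of the levels to zero enters: the failure probability of the lower
  bound on the estimator is of order \<open>exp (- u)\<close>, where \<open>u\<close> is this
  quantile up to truncation.\<close>

lemma gumbel_quantile_at_top:
  assumes "a \<longlonglongrightarrow> 0" "\<And>n. 1 \<le> n \<Longrightarrow> 0 < a n \<and> a n < (1::real)"
  shows "filterlim (\<lambda>n. gumbel_quantile (a n)) at_top sequentially"
proof -
  have "(\<lambda>n. - ln (1 - a n)) \<longlonglongrightarrow> - ln (1 - 0)" using assms(1) by (intro tendsto_intros) auto
  hence 1: "(\<lambda>n. - ln (1 - a n)) \<longlonglongrightarrow> 0" by simp
  have "eventually (\<lambda>n. 0 < - ln (1 - a n)) sequentially"
    using eventually_ge_at_top[of 1]
  proof eventually_elim
    case (elim n)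
    thus ?case using assms(2)[of n] by simp
  qed
  with 1 have "filterlim (\<lambda>n. - ln (1 - a n)) (at_right 0) sequentially"
    by (rule tendsto_imp_filterlim_at_right)
  hence "filterlim (\<lambda>n. ln (- ln (1 - a n))) at_bot sequentially"
    by (rule filterlim_compose[OF ln_at_0])
  thus ?thesis unfolding gumbel_quantile_def by (simp add: filterlim_uminus_at_top)
qed

text \<open>The quantile is at most \<open>- ln (a n)\<close>. The upper bound on the estimator
  needs this limit in order that the critical values tend to zero.\<close>

lemma gumbel_quantile_over_n:
  assumes "a \<longlonglongrightarrow> 0" "\<And>n. 1 \<le> n \<Longrightarrow> 0 < a n \<and> a n < (1::real)" "(\<lambda>n. ln (a n) / real n) \<longlonglongrightarrow> 0"
  shows "(\<lambda>n. gumbel_quantile (a n) / real n) \<longlonglongrightarrow> 0"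
proof (rule tendsto_sandwich[OF _ _ tendsto_const])
  have "eventually (\<lambda>n. 0 \<le> gumbel_quantile (a n)) sequentially"
    using gumbel_quantile_at_top[OF assms(1,2)] by (simp add: filterlim_at_top)
  thus "eventually (\<lambda>n. 0 \<le> gumbel_quantile (a n) / real n) sequentially"
    by eventually_elim simp
  show "eventually (\<lambda>n. gumbel_quantile (a n) / real n \<le> - (ln (a n) / real n)) sequentially"
    using eventually_ge_at_top[of 1]
  proof eventually_elim
    case (elim n)
    have "gumbel_quantile (a n) \<le> - ln (a n)" using assms(2)[OF elim] by (intro gumbel_quantile_le) auto
    thus ?case by (metis divide_right_mono minus_divide_left of_nat_0_le_iff)
  qed
  show "(\<lambda>n. - (ln (a n) / real n)) \<longlonglongrightarrow> 0" using tendsto_minus[OF assms(3)] by simp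
qed

text \<open>\<open>T\<close> stands for the expected number of sample points in a gap ball and
  \<open>x ^ d * n / T\<close> for the size, up to a constant, of a net of relative mesh
  \<open>1 / x\<close>. By Bernoulli's inequality the factor \<open>(1 - 1 / x) ^ d\<close> lowers
  \<open>T\<close> by at most \<open>d * D\<close>. In \<open>exp (- L)\<close> the factor
  \<open>1 / (n * x ^ (d - 1))\<close> then cancels the net size up to
  \<open>x / T \<le> 2\<close>.\<close>

lemma gap_tail_bound:
  fixes n x L T u b D :: real
  assumes n: "0 < n" "x = ln n" "2 \<le> x" and d: "1 \<le> d"
    and T: "x / 2 \<le> T" "L - 1 \<le> T" "T \<le> D * x"
    and L: "L = u + x + (real d - 1) * ln x + b"
  shows "x ^ d * n / T * exp (- (T * (1 - 1 / x) ^ d)) \<le> 2 * exp (1 + real d * D - b) * exp (- u)"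
proof -
  have x: "0 < x" and Tp: "0 < T" using n(3) T(1) by linarith+
  have "1 - real d / x \<le> (1 - 1 / x) ^ d"
    using Bernoulli_inequality[of "- (1 / x)" d] n(3) by simp
  hence "T * (1 - real d / x) \<le> T * (1 - 1 / x) ^ d" using Tp by (intro mult_left_mono) auto
  moreover have "T * (real d / x) \<le> D * x * (real d / x)" using T x by (intro mult_right_mono) auto
  hence "T - T * (1 - real d / x) \<le> real d * D" using x by (simp add: algebra_simps)
  ultimately have "L - 1 - real d * D \<le> T * (1 - 1 / x) ^ d" using T by linarith
  hence "exp (- (T * (1 - 1 / x) ^ d)) \<le> exp (- (L - 1 - real d * D))" by simp
  also have "\<dots> = exp (1 + real d * D - b) * exp (- u) * (exp (- x) * exp (- ((real d - 1) * ln x)))"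
    unfolding exp_add[symmetric] L by (simp add: algebra_simps)
  also have "exp (- x) = 1 / n" using n by (simp add: exp_minus inverse_eq_divide)
  also have "exp (- ((real d - 1) * ln x)) = 1 / x ^ (d - 1)"
  proof -
    have "exp ((real d - 1) * ln x) = exp (real (d - 1) * ln x)" using d by (simp add: of_nat_diff)
    also have "\<dots> = x ^ (d - 1)" using x by (simp add: exp_of_nat_mult)
    finally show ?thesis by (simp add: exp_minus inverse_eq_divide)
  qed
  finally have "x ^ d * n / T * exp (- (T * (1 - 1 / x) ^ d)) \<le>
      x ^ d * n / T * (exp (1 + real d * D - b) * exp (- u) * (1 / n * (1 / x ^ (d - 1))))"
    using x n Tp by (intro mult_left_mono) auto
  also have "\<dots> = (x / T) * (exp (1 + real d * D - b) * exp (- u))"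
  proof -
    have "x ^ d = x * x ^ (d - 1)" using d by (metis One_nat_def Suc_le_eq Suc_pred power_Suc)
    thus ?thesis using x n by (simp add: field_simps)
  qed
  also have "\<dots> \<le> 2 * (exp (1 + real d * D - b) * exp (- u))"
    using T(1) Tp by (intro mult_right_mono) (auto simp: field_simps)
  finally show ?thesis by simp
qed

section \<open>Deterministic bounds on the estimator\<close>

context rolling_set
begin

text \<open>For \<open>g \<le> r\<close> the hull stays inside \<open>S\<close>, so its gaps are
  balls in \<open>S\<close> that miss \<open>A\<close> and have radius at most \<rho>. The hull
  lacks at most volume \<open>s\<close> of \<open>S\<close>, which bounds the critical value from
  below, so \<open>g\<close> passes the test. The inequality for \<open>L\<close> leaves room for
  truncation.\<close>

lemma r0_estimator_lower:
  assumes A: "A \<subseteq> S" and g: "0 < g" "g \<le> r" and er: "erosion e S \<subseteq> r_convex_hull g A"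
    and shell: "measure lborel (S - erosion e S) \<le> s"
    and hit: "\<And>x. cball x \<rho> \<subseteq> S \<Longrightarrow> A \<inter> cball x \<rho> \<noteq> {}" and \<rho>: "0 \<le> \<rho>"
    and vol: "unit_ball_vol (real DIM('a)) * \<rho> ^ DIM('a) \<le> (measure lborel S - s) * L / real n"
    and L: "0 \<le> L" "L \<le> gumbel_quantile a + ln (real n) + (real DIM('a) - 1) * ln (ln (real n)) + ln (janson_beta DIM('a))"
  shows "ennreal g \<le> r0_estimator n a A"
proof -
  let ?C = "r_convex_hull g A"
  have CS: "?C \<subseteq> S"
    using r_convex_hull_mono_radius[OF g, of A] r_convex_hull_mono[OF A, of r] r_convex_hull_self by blast
  have bd: "\<rho>' \<le> \<rho>" if \<rho>': "\<rho>' \<in> insert 0 {\<rho>. 0 < \<rho> \<and> (\<exists>x. cball x \<rho> \<subseteq> ?C - A)}" for \<rho>'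
  proof (rule ccontr)
    assume less: "\<not> \<rho>' \<le> \<rho>"
    then obtain x where x: "cball x \<rho>' \<subseteq> ?C - A" using \<rho>' \<rho> by auto
    have "cball x \<rho> \<subseteq> cball x \<rho>'" using less by auto
    hence "cball x \<rho> \<subseteq> S" "A \<inter> cball x \<rho> = {}" using x CS by auto
    thus False using hit by blast
  qed
  have rad: "max_gap_radius g A \<le> \<rho>" "0 \<le> max_gap_radius g A"
    unfolding max_gap_radius_def
  proof -
    let ?T = "insert 0 {\<rho>. 0 < \<rho> \<and> (\<exists>x. cball x \<rho> \<subseteq> ?C - A)}"
    show "Sup ?T \<le> \<rho>" using bd by (intro cSup_least) auto
    have "bdd_above ?T" using bd by (intro bdd_aboveI)
    thus "0 \<le> Sup ?T" by (intro cSup_upper) auto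
  qed
  have "max_gap_volume g A = unit_ball_vol (real DIM('a)) * max_gap_radius g A ^ DIM('a)"
    unfolding max_gap_volume_def using content_cball[OF rad(2), of "0::'a"] by simp
  also have "\<dots> \<le> unit_ball_vol (real DIM('a)) * \<rho> ^ DIM('a)"
    using rad by (intro mult_left_mono power_mono) auto
  also note vol
  also have "(measure lborel S - s) * L / real n \<le> critical_value n a g A"
  proof -
    have C: "?C \<in> sets borel" by (rule borel_closed[OF closed_r_convex_hull])
    have D: "S - erosion e S \<in> sets borel" by (intro sets.Diff borel borel_closed[OF closed_erosion])
    have "measure lborel S \<le> measure lborel (?C \<union> (S - erosion e S))"
    proof (rule measure_mono_bounded)
      show "bounded (?C \<union> (S - erosion e S))" using bounded by (rule bounded_subset) (use CS in auto)
    qed (use er C D borel in auto)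
    also have "\<dots> \<le> measure lborel ?C + measure lborel (S - erosion e S)"
      using C D by (intro measure_Un_le) auto
    finally have "measure lborel S - s \<le> measure lborel ?C" using shell by simp
    hence "(measure lborel S - s) * L \<le> measure lborel ?C * L" using L by (intro mult_right_mono)
    also have "\<dots> \<le> measure lborel ?C * (gumbel_quantile a + ln (real n) + (real DIM('a) - 1) * ln (ln (real n)) + ln (janson_beta DIM('a)))"
      using L by (intro mult_left_mono) auto
    finally show ?thesis unfolding critical_value_def by (intro divide_right_mono) auto
  qed
  finally show ?thesis unfolding r0_estimator_def using g by (intro SUP_upper) auto
qed

text \<open>At every radius beyond \<open>m\<close> the hull still contains the ball about
  \<open>z\<close>, so the test rejects. All hulls lie in the convex hull of \<open>S\<close>, which
  bounds the critical values uniformly in the radius.\<close>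

lemma r0_estimator_upper:
  assumes A: "finite A" "A \<noteq> {}" "A \<subseteq> S" and m: "0 < m" and k: "0 < k" and z: "cball z k \<subseteq> r_convex_hull m A - S"
    and L: "0 \<le> L" "L = gumbel_quantile a + ln (real n) + (real DIM('a) - 1) * ln (ln (real n)) + ln (janson_beta DIM('a))"
    and small: "measure lborel (convex hull S) * L / real n < unit_ball_vol (real DIM('a)) * k ^ DIM('a)"
  shows "r0_estimator n a A \<le> ennreal m"
proof -
  have "g \<le> m" if g: "0 < g" "max_gap_volume g A \<le> critical_value n a g A" for g
  proof (rule ccontr)
    assume "\<not> g \<le> m"
    hence mg: "m \<le> g" by simp
    let ?C = "r_convex_hull g A"
    have C: "?C \<subseteq> convex hull S"
      using r_convex_hull_subset_convex_hull[OF finite_imp_compact[OF A(1)] A(2) g(1)] hull_mono[OF A(3)] by blast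
    have comp: "compact (convex hull S)" using compact by (rule compact_convex_hull)
    then obtain R where R: "convex hull S \<subseteq> cball 0 R"
      by (meson compact_imp_bounded bounded_iff mem_cball_0 subsetI)
    let ?T = "insert 0 {\<rho>. 0 < \<rho> \<and> (\<exists>x. cball x \<rho> \<subseteq> ?C - A)}"
    have "cball z k \<subseteq> ?C - A" using z r_convex_hull_mono_radius[OF m mg, of A] A(3) by blast
    hence kT: "k \<in> ?T" using k by auto
    have "bdd_above ?T"
    proof (rule bdd_aboveI)
      fix \<rho> assume "\<rho> \<in> ?T"
      then consider "\<rho> = 0" | x where "0 < \<rho>" "cball x \<rho> \<subseteq> ?C - A" by auto
      thus "\<rho> \<le> max 0 R"
      proof cases
        case 2
        hence "cball x \<rho> \<subseteq> cball 0 R" using C R by blast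
        thus ?thesis using 2(1) unfolding cball_subset_cball_iff using zero_le_dist[of x 0] by linarith
      qed simp
    qed
    hence rad: "k \<le> max_gap_radius g A" unfolding max_gap_radius_def using kT by (intro cSup_upper)
    have "unit_ball_vol (real DIM('a)) * k ^ DIM('a) \<le> unit_ball_vol (real DIM('a)) * max_gap_radius g A ^ DIM('a)"
      using rad k by (intro mult_left_mono power_mono) auto
    also have "\<dots> = max_gap_volume g A"
      unfolding max_gap_volume_def using content_cball[of "max_gap_radius g A" "0::'a"] rad k by simp
    also note g(2)
    also have "critical_value n a g A \<le> measure lborel (convex hull S) * L / real n"
      unfolding critical_value_def L(2)[symmetric]
    proof (intro divide_right_mono mult_right_mono L(1))
      show "measure lborel ?C \<le> measure lborel (convex hull S)"
        using C comp by (intro measure_mono_bounded borel_closed closed_r_convex_hull compact_imp_closed compact_imp_bounded)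
    qed simp
    finally show False using small by simp
  qed
  thus ?thesis unfolding r0_estimator_def by (intro SUP_least) (auto intro: ennreal_leI)
qed

text \<open>The bounds on \<open>rn\<close> keep it away from \<open>0\<close> and \<infinity>,
  where \<open>r_convex_hull_ext\<close> follows a convention. Monotonicity then puts the hull
  between the erosion and \<open>r_convex_hull m S\<close>.\<close>

lemma hull_distances:
  assumes A: "A \<subseteq> S" and e: "0 < e" "e \<le> l" and er: "erosion e S \<subseteq> r_convex_hull g A"
    and g: "0 < g" "ennreal g \<le> rn" "rn \<le> ennreal m" and m: "r_convex_hull m S = S"
  shows "\<bar>hausdorff_distance S (r_convex_hull_ext rn A)\<bar> \<le> e"
    and "\<bar>hausdorff_distance (frontier S) (frontier (r_convex_hull_ext rn A))\<bar> \<le> 2 * e"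
    and "\<bar>measure_distance S (r_convex_hull_ext rn A)\<bar> \<le> measure lborel (S - erosion e S)"
proof -
  define h where "h = enn2real rn"
  have "rn < \<infinity>" using g(3) by (rule le_less_trans) simp
  hence rn: "rn = ennreal h" "0 \<le> h" by (simp_all add: h_def)
  have h: "g \<le> h" using g rn by (simp add: ennreal_le_iff)
  have "0 < m"
  proof (rule ccontr)
    assume "\<not> 0 < m"
    hence "ennreal m = 0" by (simp add: ennreal_neg)
    hence "ennreal h \<le> 0" using g(3) unfolding rn(1) by simp
    thus False using h g(1) by (simp add: ennreal_eq_0_iff)
  qed
  hence hm: "h \<le> m" using g rn by (simp add: ennreal_le_iff)
  have eq: "r_convex_hull_ext rn A = r_convex_hull h A"
    using rn h g(1) by (simp add: r_convex_hull_ext_def h_def[symmetric] ennreal_eq_0_iff)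
  have 1: "erosion e S \<subseteq> r_convex_hull h A"
    using er r_convex_hull_mono_radius[OF g(1) h, of A] by blast
  have 2: "r_convex_hull h A \<subseteq> S"
    using r_convex_hull_mono_radius[of h m A] r_convex_hull_mono[OF A, of m] m h g(1) hm by auto
  show "\<bar>hausdorff_distance S (r_convex_hull_ext rn A)\<bar> \<le> e"
    "\<bar>hausdorff_distance (frontier S) (frontier (r_convex_hull_ext rn A))\<bar> \<le> 2 * e"
    "\<bar>measure_distance S (r_convex_hull_ext rn A)\<bar> \<le> measure lborel (S - erosion e S)"
    unfolding eq using distances_from_erosion[OF e 1 2 closed_r_convex_hull] by auto
qed

end

section \<open>High-probability events and their combination\<close>

context uniform_sample
begin

text \<open>With \<open>K\<close> as chosen the exponential factor is \<open>n\<close> to the power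
  \<open>- (DIM('a) + 1)\<close>, while the net has at most of order \<open>n ^ DIM('a)\<close>
  points. The failure probability is of order \<open>1 / n\<close>.\<close>

lemma erosion_covered_eventually:
  assumes g: "0 < g" "g / 2 \<le> l"
  defines "p \<equiv> 2 / (real DIM('a) + 1)"
  obtains K E where "0 < K" "\<And>n. E n \<in> events" "(\<lambda>n. prob (E n)) \<longlonglongrightarrow> 0"
    "eventually (\<lambda>n. \<forall>\<omega>\<in>space M - E n. erosion (K * (ln (real n) / real n) powr p) S \<subseteq> r_convex_hull g (sample n \<omega>)) sequentially"
proof -
  let ?d = "DIM('a)"
  let ?c = "cap_const (g / 2)"
  obtain R where R: "S \<subseteq> cball 0 R" "0 \<le> R"
    using bounded by (metis bounded_pos mem_cball_0 subsetI less_imp_le)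
  have c: "0 < ?c" using cap_const_pos[of "g / 2"] g by simp
  \<comment> \<open>Makes the exponent in \<open>erosion_covered_event\<close> equal to
    \<open>- (DIM('a) + 1) * ln n\<close>; \<open>K\<close> is such that
    \<open>(e n / 2) powr ((DIM('a) + 1) / 2) = q * ln n / n\<close>.\<close>
  define q where "q = measure lborel S * (real ?d + 1) / ?c"
  have q: "0 < q" using c measure_pos by (simp add: q_def)
  define K where "K = 2 * q powr p"
  have K: "0 < K" using q by (simp add: K_def)
  have p: "0 < p" "p \<le> 1" "p * ((real ?d + 1) / 2) = 1"
    using DIM_positive[where 'a='a] by (auto simp: p_def field_simps)
  define e where "e n = K * (ln (real n) / real n) powr p" for n :: nat
  define b where "b n = (8 * (R + g) / e n + 1) ^ ?d *
      exp (- real n * (?c * (e n / 2) powr ((real ?d + 1) / 2)) / measure lborel S)" for n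
  have "(\<lambda>n. ln (real n) / real n) \<longlonglongrightarrow> 0" by (rule lim_ln_over_n)
  hence "(\<lambda>n. (ln (real n) / real n) powr p) \<longlonglongrightarrow> 0"
    using p by (intro tendsto_zero_powrI[OF _ tendsto_const] eventually_mono[OF eventually_ge_at_top[of 1]]) auto
  hence "(\<lambda>n. K * (ln (real n) / real n) powr p) \<longlonglongrightarrow> K * 0" by (intro tendsto_intros)
  hence "e \<longlonglongrightarrow> 0" by (simp add: e_def[abs_def])
  hence e_small: "eventually (\<lambda>n. e n < g / 2) sequentially" using g by (intro order_tendstoD(2)) auto
  have ev_n: "eventually (\<lambda>n. 3 \<le> n) sequentially" by (rule eventually_ge_at_top)
  have ln1: "1 \<le> ln (real n)" if "3 \<le> n" for n
  proof -
    have "exp 1 \<le> real n" using exp_le that by linarith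
    thus ?thesis using that by (simp add: ln_ge_iff)
  qed
  have "\<forall>n. \<exists>E\<in>events. 3 \<le> n \<and> e n < g / 2 \<longrightarrow> prob E \<le> b n \<and>
      (\<forall>\<omega>\<in>space M - E. erosion (e n) S \<subseteq> r_convex_hull g (sample n \<omega>))"
  proof
    fix n
    show "\<exists>E\<in>events. 3 \<le> n \<and> e n < g / 2 \<longrightarrow> prob E \<le> b n \<and>
      (\<forall>\<omega>\<in>space M - E. erosion (e n) S \<subseteq> r_convex_hull g (sample n \<omega>))"
    proof (cases "3 \<le> n \<and> e n < g / 2")
      case True
      hence "0 < ln (real n) / real n" using ln1[of n] by (intro divide_pos_pos) auto
      hence e: "0 < e n" "e n \<le> g / 2" "1 \<le> n" using True K by (auto simp: e_def)
      show ?thesis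
        using erosion_covered_event[OF e(3) e(1,2) g(2) R] unfolding b_def by metis
    qed (use sets.empty_sets in blast)
  qed
  then obtain E where E: "\<And>n. E n \<in> events" and
    E': "\<And>n. 3 \<le> n \<Longrightarrow> e n < g / 2 \<Longrightarrow> prob (E n) \<le> b n \<and>
      (\<forall>\<omega>\<in>space M - E n. erosion (e n) S \<subseteq> r_convex_hull g (sample n \<omega>))"
    by metis
  define A where "A = (8 * (R + g) / K + 1) ^ ?d"
  have b_le: "b n \<le> A / real n" if n: "3 \<le> n" for n
  proof -
    let ?y = "ln (real n) / real n"
    have y: "0 < ?y" "1 / real n \<le> ?y" "?y \<le> 1" using ln1[OF n] n ln_le_minus_one[of "real n"]
      by (auto intro: divide_right_mono)
    have "?y powr 1 = ?y" using y(1) by (simp only: powr_one_gt_zero_iff)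
    hence "1 / real n \<le> ?y powr 1" using y(2) by (simp only:)
    \<comment> \<open>Both \<open>?y\<close> and \<open>p\<close> are at most \<open>1\<close>, so
      \<open>e n\<close> is at least of order \<open>1 / n\<close>, which bounds the net size
      polynomially.\<close>
    also have "\<dots> \<le> ?y powr p" using y p by (intro powr_mono') auto
    finally have "K * (1 / real n) \<le> e n" unfolding e_def using K by (intro mult_left_mono) auto
    hence "K / real n \<le> e n" by simp
    hence "8 * (R + g) / e n \<le> 8 * (R + g) / (K / real n)"
      using R g K n by (intro divide_left_mono mult_pos_pos) (auto simp: e_def intro!: mult_pos_pos divide_pos_pos)
    also have "\<dots> = 8 * (R + g) / K * real n" by simp
    finally have "8 * (R + g) / e n + 1 \<le> (8 * (R + g) / K + 1) * real n"
      using n by (simp add: algebra_simps)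
    moreover have "0 \<le> 8 * (R + g) / e n + 1" using R g K by (simp add: e_def)
    ultimately have "(8 * (R + g) / e n + 1) ^ ?d \<le> A * real n ^ ?d"
      unfolding A_def power_mult_distrib[symmetric] by (intro power_mono)
    moreover have "exp (- real n * (?c * (e n / 2) powr ((real ?d + 1) / 2)) / measure lborel S) = 1 / real n ^ (?d + 1)"
    proof -
      have "e n / 2 = q powr p * ?y powr p" by (simp add: e_def K_def)
      also have "\<dots> = (q * ?y) powr p" by (rule powr_mult[symmetric])
      finally have "e n / 2 = (q * ?y) powr p" .
      hence "(e n / 2) powr ((real ?d + 1) / 2) = (q * ?y) powr 1" by (simp only: powr_powr p(3))
      also have "\<dots> = q * ?y" using mult_pos_pos[OF q y(1)] by (simp only: powr_one_gt_zero_iff)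
      finally have pw: "(e n / 2) powr ((real ?d + 1) / 2) = q * ?y" .
      have "- real n * (?c * (e n / 2) powr ((real ?d + 1) / 2)) / measure lborel S = - (real (?d + 1) * ln (real n))"
        unfolding pw using c measure_pos n by (simp add: q_def)
      thus ?thesis using n by (simp add: exp_minus exp_of_nat_mult inverse_eq_divide del: of_nat_add of_nat_Suc)
    qed
    ultimately have "b n \<le> A * real n ^ ?d * (1 / real n ^ (?d + 1))"
      unfolding b_def by (intro mult_mono) (auto simp: A_def R g K less_imp_le)
    also have "\<dots> = A / real n" using n by simp
    finally show ?thesis .
  qed
  have "(\<lambda>n. prob (E n)) \<longlonglongrightarrow> 0"
  proof (rule tendsto_sandwich[OF _ _ tendsto_const])
    show "eventually (\<lambda>n. prob (E n) \<le> A / real n) sequentially"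
      using ev_n e_small
    proof eventually_elim
      case (elim n)
      thus ?case using E'[of n] b_le[of n] by linarith
    qed
    show "(\<lambda>n. A / real n) \<longlonglongrightarrow> 0" by (rule lim_const_over_n)
  qed simp
  moreover have "eventually (\<lambda>n. \<forall>\<omega>\<in>space M - E n. erosion (e n) S \<subseteq> r_convex_hull g (sample n \<omega>)) sequentially"
    using ev_n e_small by eventually_elim (use E' in blast)
  ultimately show ?thesis using K E unfolding e_def by (intro that[of K E])
qed

text \<open>The radius \<rho> equates the ball volume with a lower bound for the critical value that
  includes the volume deficit \<open>c * e n\<close> of the hull. With a net of mesh
  \<open>\<rho> n / ln n\<close>, \<open>gap_tail_bound\<close> gives a failure probability of order
  \<open>exp (- u n)\<close>.\<close>

lemma balls_hit_eventually:
  assumes e: "(\<lambda>n. e n * ln (real n)) \<longlonglongrightarrow> 0"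
    and u: "filterlim u at_top sequentially" "\<And>n. u n \<le> ln (real n)"
    and L: "\<And>n. L n = u n + ln (real n) + (real DIM('a) - 1) * ln (ln (real n)) + b"
  obtains \<rho> E where "\<And>n. E n \<in> events" "(\<lambda>n. prob (E n)) \<longlonglongrightarrow> 0" "\<rho> \<longlonglongrightarrow> 0"
    "eventually (\<lambda>n. 0 < \<rho> n \<and> 0 \<le> L n \<and>
      unit_ball_vol (real DIM('a)) * \<rho> n ^ DIM('a) = (measure lborel S - c * e n) * L n / real n \<and>
      (\<forall>\<omega>\<in>space M - E n. \<forall>x. cball x (\<rho> n) \<subseteq> S \<longrightarrow> sample n \<omega> \<inter> cball x (\<rho> n) \<noteq> {})) sequentially"
proof -
  let ?d = "DIM('a)"
  let ?w = "unit_ball_vol (real DIM('a))"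
  let ?m = "measure lborel S"
  obtain R where R: "S \<subseteq> cball 0 R" "0 \<le> R"
    using bounded by (metis bounded_pos mem_cball_0 subsetI less_imp_le)
  have w: "0 < ?w" by simp
  have m: "0 < ?m" by (rule measure_pos)
  have d1: "1 \<le> ?d" using DIM_positive[where 'a='a] by linarith
  \<comment> \<open>The expected number of sample points in a ball of radius \<open>\<rho> n\<close>
    inside \<open>S\<close>. Eventually it differs from \<open>L n\<close> by less than one:
    \<open>L n\<close> is of order \<open>ln n\<close> because \<open>u n \<le> ln n\<close>, and
    \<open>e n * ln n\<close> tends to zero.\<close>
  define T where "T n = (1 - c / ?m * e n) * L n" for n
  define t where "t n = (?m - c * e n) * L n / real n" for n
  define \<rho> where "\<rho> n = (t n / ?w) powr (1 / real ?d)" for n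
  define \<delta> where "\<delta> n = \<rho> n / ln (real n)" for n
  \<comment> \<open>Eventually \<open>L n \<le> (DIM('a) + 2) * ln n\<close>; the extra unit absorbs
    the difference between \<open>T n\<close> and \<open>L n\<close>.\<close>
  define D where "D = real ?d + 3"
  have "?m * (1 - c / ?m * e n) = ?m - c * e n" for n using m by (simp add: algebra_simps)
  hence tT: "t n = ?m * T n / real n" for n unfolding t_def T_def mult.assoc[symmetric] by simp
  have ln_top: "filterlim (\<lambda>n. ln (real n)) at_top sequentially"
    by (rule filterlim_compose[OF ln_at_top filterlim_real_sequentially])
  have ev_x: "eventually (\<lambda>n. max 2 b \<le> ln (real n)) sequentially"
    using ln_top unfolding filterlim_at_top by blast
  have ev_u: "eventually (\<lambda>n. - b \<le> u n) sequentially" using u(1) by (simp add: filterlim_at_top)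
  have "(\<lambda>n. \<bar>c / ?m * (e n * ln (real n))\<bar> * (real ?d + 2)) \<longlonglongrightarrow> \<bar>c / ?m * 0\<bar> * (real ?d + 2)"
    using e by (intro tendsto_intros)
  hence ev_e: "eventually (\<lambda>n. \<bar>c / ?m * (e n * ln (real n))\<bar> * (real ?d + 2) < 1) sequentially"
    by (intro order_tendstoD(2)) auto
  have ev_main: "eventually (\<lambda>n. 1 \<le> n \<and> 2 \<le> ln (real n) \<and> 0 \<le> L n \<and> ln (real n) / 2 \<le> T n \<and> L n - 1 \<le> T n \<and> T n \<le> D * ln (real n)) sequentially"
    using ev_x ev_u ev_e eventually_ge_at_top[of 1]
  proof eventually_elim
    case (elim n)
    let ?x = "ln (real n)"
    have x: "2 \<le> ?x" "b \<le> ?x" using elim by auto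
    have lx: "0 \<le> ln ?x" "ln ?x \<le> ?x" using x ln_le_minus_one[of ?x] by auto
    have dx: "0 \<le> (real ?d - 1) * ln ?x" using lx d1 by simp
    have dx2: "(real ?d - 1) * ln ?x \<le> (real ?d - 1) * ?x" using lx d1 by (intro mult_left_mono) auto
    have "- b \<le> u n" using elim by simp
    hence L1: "?x \<le> L n" unfolding L using dx by linarith
    have L2: "L n \<le> (real ?d + 2) * ?x" using dx2 u(2)[of n] x unfolding L by (simp add: algebra_simps)
    have "\<bar>c / ?m * e n * L n\<bar> = \<bar>c / ?m * e n\<bar> * L n" using L1 x by (simp add: abs_mult)
    also have "\<dots> \<le> \<bar>c / ?m * e n\<bar> * ((real ?d + 2) * ?x)" using L2 by (intro mult_left_mono) auto
    also have "\<dots> = \<bar>c / ?m * (e n * ?x)\<bar> * (real ?d + 2)" using x by (simp add: abs_mult)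
    also have "\<dots> < 1" using elim by simp
    finally have "\<bar>c / ?m * e n * L n\<bar> < 1" .
    moreover have "T n = L n - c / ?m * e n * L n" unfolding T_def by (simp only: left_diff_distrib mult_1)
    ultimately have T1: "L n - 1 \<le> T n" "T n \<le> L n + 1" unfolding abs_less_iff by linarith+
    have "T n \<le> D * ?x" using T1 L2 x unfolding D_def by (simp add: algebra_simps)
    thus ?case using T1 L1 x elim by auto
  qed
  have t0: "t \<longlonglongrightarrow> 0"
  proof (rule tendsto_sandwich[OF _ _ tendsto_const])
    show "eventually (\<lambda>n. 0 \<le> t n) sequentially" using ev_main
      by eventually_elim (use m in \<open>auto simp: tT\<close>)
    show "eventually (\<lambda>n. t n \<le> ?m * D * (ln (real n) / real n)) sequentially" using ev_main
      by eventually_elim (use m in \<open>auto simp: tT intro!: divide_right_mono\<close>)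
    have "(\<lambda>n. ?m * D * (ln (real n) / real n)) \<longlonglongrightarrow> ?m * D * 0"
      by (intro tendsto_intros lim_ln_over_n)
    thus "(\<lambda>n. ?m * D * (ln (real n) / real n)) \<longlonglongrightarrow> 0" by simp
  qed
  have t_pos: "eventually (\<lambda>n. 0 < t n) sequentially" using ev_main
    by eventually_elim (use m in \<open>auto simp: tT\<close>)
  have "?w \<noteq> 0" using w by linarith
  with t0 have "(\<lambda>n. t n / ?w) \<longlonglongrightarrow> 0 / ?w" by (intro tendsto_intros)
  hence tw: "(\<lambda>n. t n / ?w) \<longlonglongrightarrow> 0" by simp
  have \<rho>0: "\<rho> \<longlonglongrightarrow> 0" unfolding \<rho>_def
    using tw d1 t_pos by (intro tendsto_zero_powrI[OF _ tendsto_const]) (auto elim!: eventually_mono)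
  have \<rho>_pow: "?w * \<rho> n ^ ?d = t n" if "0 < t n" for n
  proof -
    have s: "0 < t n / ?w" using that w by (rule divide_pos_pos)
    have "0 < \<rho> n" unfolding \<rho>_def powr_gt_zero using s by linarith
    hence "\<rho> n ^ ?d = \<rho> n powr real ?d" by (rule powr_realpow[symmetric])
    also have "\<dots> = (t n / ?w) powr (1 / real ?d * real ?d)" unfolding \<rho>_def by (rule powr_powr)
    also have "1 / real ?d * real ?d = 1" using d1 by simp
    also have "(t n / ?w) powr 1 = t n / ?w" using s by (simp only: powr_one_gt_zero_iff)
    finally have "?w * \<rho> n ^ ?d = ?w * (t n / ?w)" by simp
    also have "\<dots> = t n" using \<open>?w \<noteq> 0\<close> by simp
    finally show ?thesis .
  qed
  define P where "P n \<longleftrightarrow> 1 \<le> n \<and> 2 \<le> ln (real n) \<and> 0 < t n \<and> 0 \<le> L n" for n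
  define B where "B n = ((2 * R + \<delta> n) / \<delta> n) ^ ?d * exp (- real n * (?w * (\<rho> n - \<delta> n) ^ ?d) / ?m)" for n
  have ev_P: "eventually P sequentially" using ev_main t_pos by eventually_elim (auto simp: P_def)
  have \<delta>: "0 < \<rho> n" "0 < \<delta> n" "\<delta> n < \<rho> n" if P: "P n" for n
  proof -
    have "0 < t n / ?w" using P w by (intro divide_pos_pos) (simp_all add: P_def)
    hence pos: "0 < \<rho> n" unfolding \<rho>_def powr_gt_zero by linarith
    have frac: "0 < s / x" "s / x < s" if "0 < s" "2 \<le> x" for s x :: real
      using that mult_strict_left_mono[of 1 x s] by (simp_all add: pos_divide_less_eq)
    show "0 < \<rho> n" "0 < \<delta> n" "\<delta> n < \<rho> n"
      unfolding \<delta>_def using pos frac[OF pos] P by (simp_all only: P_def)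
  qed
  have "\<forall>n. \<exists>E\<in>events. P n \<longrightarrow> prob E \<le> B n \<and>
      (\<forall>\<omega>\<in>space M - E. \<forall>x. cball x (\<rho> n) \<subseteq> S \<longrightarrow> sample n \<omega> \<inter> cball x (\<rho> n) \<noteq> {})"
  proof
    fix n
    show "\<exists>E\<in>events. P n \<longrightarrow> prob E \<le> B n \<and>
      (\<forall>\<omega>\<in>space M - E. \<forall>x. cball x (\<rho> n) \<subseteq> S \<longrightarrow> sample n \<omega> \<inter> cball x (\<rho> n) \<noteq> {})"
    proof (cases "P n")
      case True
      hence n: "1 \<le> n" by (simp add: P_def)
      show ?thesis using balls_hit_event[OF n \<delta>(2,3)[OF True] R] unfolding B_def by metis
    qed (use sets.empty_sets in blast)
  qed
  then obtain E where E: "\<And>n. E n \<in> events" and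
    E': "\<And>n. P n \<Longrightarrow> prob (E n) \<le> B n \<and>
      (\<forall>\<omega>\<in>space M - E n. \<forall>x. cball x (\<rho> n) \<subseteq> S \<longrightarrow> sample n \<omega> \<inter> cball x (\<rho> n) \<noteq> {})"
    by metis
  \<comment> \<open>Collects the constants of the net size, which is at most \<open>C1\<close> times
    \<open>ln n ^ DIM('a) * n / T n\<close> once \<open>\<rho> n < 1\<close>.\<close>
  define C1 where "C1 = (2 * R + 1) ^ ?d * ?w / ?m"
  have C1: "0 \<le> C1" using R w m by (simp add: C1_def)
  have "eventually (\<lambda>n. \<rho> n < 1) sequentially" using \<rho>0 by (intro order_tendstoD(2)) auto
  with ev_main ev_P have B_le: "eventually (\<lambda>n. B n \<le> C1 * (2 * exp (1 + real ?d * D - b) * exp (- u n))) sequentially"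
  proof eventually_elim
    case (elim n)
    let ?x = "ln (real n)"
    have x: "2 \<le> ?x" and n: "0 < real n" and Tp: "0 < T n" and P: "P n" using elim by auto
    have tp: "0 < t n" using P by (simp add: P_def)
    have "\<delta> n \<le> 1" using \<delta>[OF P] elim by linarith
    hence "(2 * R + \<delta> n) / \<delta> n \<le> (2 * R + 1) / \<delta> n" using \<delta>[OF P] by (intro divide_right_mono) auto
    hence "((2 * R + \<delta> n) / \<delta> n) ^ ?d \<le> ((2 * R + 1) / \<delta> n) ^ ?d"
      using R \<delta>[OF P] by (intro power_mono) auto
    also have "\<dots> = (2 * R + 1) ^ ?d * ?x ^ ?d / \<rho> n ^ ?d"
      by (simp add: \<delta>_def power_divide power_mult_distrib)
    also have "\<rho> n ^ ?d = t n / ?w"      by (subst \<rho>_pow[OF tp, symmetric]) (rule nonzero_mult_div_cancel_left[OF \<open>?w \<noteq> 0\<close>, symmetric])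
    also have "(2 * R + 1) ^ ?d * ?x ^ ?d / (t n / ?w) = C1 * (?x ^ ?d * real n / T n)"
      using m w n Tp by (simp add: C1_def tT)
    finally have 1: "((2 * R + \<delta> n) / \<delta> n) ^ ?d \<le> C1 * (?x ^ ?d * real n / T n)" .
    have "\<rho> n - \<delta> n = \<rho> n * (1 - 1 / ?x)" by (simp add: \<delta>_def algebra_simps)
    hence "?w * (\<rho> n - \<delta> n) ^ ?d = t n * (1 - 1 / ?x) ^ ?d"
      using \<rho>_pow[OF tp] by (simp add: power_mult_distrib mult.assoc[symmetric])
    hence 2: "- real n * (?w * (\<rho> n - \<delta> n) ^ ?d) / ?m = - (T n * (1 - 1 / ?x) ^ ?d)"
      using m n by (simp add: tT)
    have "B n \<le> C1 * (?x ^ ?d * real n / T n) * exp (- (T n * (1 - 1 / ?x) ^ ?d))"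
      unfolding B_def 2 using 1 by (intro mult_right_mono) auto
    also have "\<dots> = C1 * (?x ^ ?d * real n / T n * exp (- (T n * (1 - 1 / ?x) ^ ?d)))" by simp
    also have "\<dots> \<le> C1 * (2 * exp (1 + real ?d * D - b) * exp (- u n))"
      using elim d1 C1 by (intro mult_left_mono gap_tail_bound[where L = "L n"]) (auto simp: L)
    finally show ?case .
  qed
  have "(\<lambda>n. prob (E n)) \<longlonglongrightarrow> 0"
  proof (rule tendsto_sandwich[OF _ _ tendsto_const])
    show "eventually (\<lambda>n. prob (E n) \<le> C1 * (2 * exp (1 + real ?d * D - b) * exp (- u n))) sequentially"
      using B_le ev_P
    proof eventually_elim
      case (elim n)
      thus ?case using E'[of n] by linarith
    qed
    have "(\<lambda>n. exp (- u n)) \<longlonglongrightarrow> 0"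
      using u(1) by (intro filterlim_compose[OF exp_at_bot]) (simp add: filterlim_uminus_at_bot)
    hence "(\<lambda>n. C1 * (2 * exp (1 + real ?d * D - b) * exp (- u n))) \<longlonglongrightarrow> C1 * (2 * exp (1 + real ?d * D - b) * 0)"
      by (intro tendsto_intros)
    thus "(\<lambda>n. C1 * (2 * exp (1 + real ?d * D - b) * exp (- u n))) \<longlonglongrightarrow> 0" by simp
  qed simp
  moreover have "eventually (\<lambda>n. 0 < \<rho> n \<and> 0 \<le> L n \<and>
      ?w * \<rho> n ^ ?d = (?m - c * e n) * L n / real n \<and>
      (\<forall>\<omega>\<in>space M - E n. \<forall>x. cball x (\<rho> n) \<subseteq> S \<longrightarrow> sample n \<omega> \<inter> cball x (\<rho> n) \<noteq> {})) sequentially"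
    using ev_P
  proof eventually_elim
    case (elim n)
    have "0 < t n" "0 \<le> L n" using elim by (auto simp: P_def)
    thus ?case using \<rho>_pow[of n] \<delta>(1)[OF elim] E'[OF elim] by (auto simp: t_def)
  qed
  ultimately show ?thesis using E \<rho>0 by (intro that[of E \<rho>])
qed

text \<open>Off three exceptional events the erosion is covered, every ball of radius
  \<open>\<rho> n\<close> in \<open>S\<close> is hit, and the sample lies in \<open>S\<close>. Then
  the estimator lies between \<open>g\<close> and \<open>m\<close>, and
  \<open>hull_distances\<close> applies with the radii \<open>\<nu> * g\<close> and
  \<open>\<nu> * m\<close>.\<close>

lemma sample_hull_distances:
  fixes a :: "nat \<Rightarrow> real" and \<nu> :: real
  assumes nonconvex: "\<not> convex S" and a: "a \<longlonglongrightarrow> 0" "\<And>n. 1 \<le> n \<Longrightarrow> 0 < a n \<and> a n < 1"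
    "(\<lambda>n. ln (a n) / real n) \<longlonglongrightarrow> 0" and \<nu>: "0 < \<nu>" "\<nu> < 1"
  defines "H \<equiv> \<lambda>n \<omega>. r_convex_hull_ext (ennreal \<nu> * r0_estimator n (a n) (sample n \<omega>)) (sample n \<omega>)"
    and "rate \<equiv> \<lambda>n. (ln (real n) / real n) powr (2 / (real DIM('a) + 1))"
  obtains K E where "\<And>n. E n \<in> events" "(\<lambda>n. prob (E n)) \<longlonglongrightarrow> 0"
    "eventually (\<lambda>n. \<forall>\<omega>\<in>space M - E n. \<bar>hausdorff_distance S (H n \<omega>)\<bar> \<le> K * rate n \<and>
       \<bar>hausdorff_distance (frontier S) (frontier (H n \<omega>))\<bar> \<le> K * rate n \<and>
       \<bar>measure_distance S (H n \<omega>)\<bar> \<le> K * rate n) sequentially"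
proof -
  let ?d = "real DIM('a)"
  \<comment> \<open>\<open>g \<le> r\<close> keeps the hulls inside \<open>S\<close>, and
    \<open>g \<le> l\<close> makes inner balls of the size used in the cap estimate
    available.\<close>
  define g where "g = min r l"
  have g: "0 < g" "g \<le> r" "g \<le> l" using r_pos l_pos by (auto simp: g_def)
  obtain C where C: "0 < C" "\<And>e. 0 < e \<Longrightarrow> measure lborel (S - erosion e S) \<le> C * e"
    using shell_measure by blast
  obtain r0 where r0: "r \<le> r0" "\<And>g. 0 < g \<Longrightarrow> g < r0 \<Longrightarrow> r_convex_hull g S = S"
    "\<And>g. r0 < g \<Longrightarrow> r_convex_hull g S \<noteq> S"
    using reach_radius[OF nonconvex] by blast
  have r0p: "0 < r0" using r0(1) r_pos by simp
  \<comment> \<open>The midpoint of \<open>r0\<close> and \<open>r0 / \<nu>\<close>: beyond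
    \<open>r0\<close> the hull of \<open>S\<close> exceeds \<open>S\<close>, so the test can reject,
    while \<open>\<nu> * m < r0\<close> keeps the final hull inside \<open>S\<close>.\<close>
  define m where "m = r0 * (1 + 1 / \<nu>) / 2"
  have m: "r0 < m" "\<nu> * m < r0" "0 < m"
  proof -
    have "1 < 1 / \<nu>" using \<nu> by simp
    hence "r0 * 2 < r0 * (1 + 1 / \<nu>)" using r0p by (intro mult_strict_left_mono) auto
    thus "r0 < m" by (simp add: m_def)
    thus "0 < m" using r0p by simp
    have "\<nu> * m = r0 * ((\<nu> + 1) / 2)" using \<nu> by (simp add: m_def field_simps)
    also have "\<dots> < r0 * 1" using r0p \<nu> by (intro mult_strict_left_mono) auto
    finally show "\<nu> * m < r0" by simp
  qed
  \<comment> \<open>Strictly between \<open>r0\<close> and \<open>m\<close>: at \<open>g'\<close>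
    the hull of \<open>S\<close> has a point outside \<open>S\<close>, and \<open>hull_gap\<close>
    turns it into a ball at radius \<open>m\<close>.\<close>
  define g' where "g' = (r0 + m) / 2"
  have g': "r0 < g'" "0 < g'" "g' < m" using m r0p by (auto simp: g'_def)
  then obtain z where z: "z \<in> r_convex_hull g' S" "z \<notin> S"
    using r0(3)[OF g'(1)] r_convex_hull_superset by blast
  obtain k where k: "0 < k"
    "\<And>A. A \<subseteq> S \<Longrightarrow> (\<And>s. s \<in> S \<Longrightarrow> \<exists>a\<in>A. dist s a < k) \<Longrightarrow> cball z k \<subseteq> r_convex_hull m A - S"
    using hull_gap[OF g'(2,3) z] by blast
  \<comment> \<open>Coverage is needed already at \<open>\<nu> * g\<close>, the lower bound for the
    final radius; coverage at \<open>g\<close> follows by monotonicity.\<close>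
  have \<nu>g: "0 < \<nu> * g" "\<nu> * g \<le> g" using \<nu> g by auto
  hence "\<nu> * g / 2 \<le> l" using g by linarith
  then obtain K E1 where K: "0 < K" and E1: "\<And>n. E1 n \<in> events" "(\<lambda>n. prob (E1 n)) \<longlonglongrightarrow> 0"
    "eventually (\<lambda>n. \<forall>\<omega>\<in>space M - E1 n. erosion (K * rate n) S \<subseteq> r_convex_hull (\<nu> * g) (sample n \<omega>)) sequentially"
    unfolding rate_def using erosion_covered_eventually[OF \<nu>g(1)] by blast
  define e where "e n = K * rate n" for n
  have p: "0 < 2 / (?d + 1)" by (simp add: add_pos_nonneg)
  have "(\<lambda>n. rate n * ln (real n)) \<longlonglongrightarrow> 0" unfolding rate_def using p by real_asymp
  from tendsto_mult[OF tendsto_const[of K] this] have e_ln: "(\<lambda>n. e n * ln (real n)) \<longlonglongrightarrow> 0" by (simp add: e_def mult.assoc)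
  have "rate \<longlonglongrightarrow> 0" unfolding rate_def using p by real_asymp
  from tendsto_mult[OF tendsto_const[of K] this] have e0: "e \<longlonglongrightarrow> 0" by (simp add: e_def[abs_def])
  define b where "b = ln (janson_beta DIM('a))"
  \<comment> \<open>\<open>a n\<close> may decay faster than any power of \<open>n\<close>; the truncation keeps the threshold of order \<open>ln n\<close>,
    so that the deficit \<open>C * e n\<close> in the volume of the hull is negligible\<close>
  define u where "u n = min (gumbel_quantile (a n)) (ln (real n))" for n
  \<comment> \<open>The truncated bracket \<open>L\<close> serves the lower bound on the estimator,
    the full bracket \<open>L'\<close> of the critical value the upper bound.\<close>
  define L where "L n = u n + ln (real n) + (?d - 1) * ln (ln (real n)) + b" for n
  define L' where "L' n = gumbel_quantile (a n) + ln (real n) + (?d - 1) * ln (ln (real n)) + b" for n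
  have LL': "L n \<le> L' n" for n by (simp add: L_def L'_def u_def)
  have ln_top: "filterlim (\<lambda>n. ln (real n)) at_top sequentially"
    by (rule filterlim_compose[OF ln_at_top filterlim_real_sequentially])
  have u_top: "filterlim u at_top sequentially"
    unfolding filterlim_at_top
  proof
    fix Z
    have "eventually (\<lambda>n. Z \<le> gumbel_quantile (a n)) sequentially" "eventually (\<lambda>n. Z \<le> ln (real n)) sequentially"
      using gumbel_quantile_at_top[OF a(1,2)] ln_top by (auto simp: filterlim_at_top)
    thus "eventually (\<lambda>n. Z \<le> u n) sequentially" by eventually_elim (simp add: u_def)
  qed
  have u_le: "u n \<le> ln (real n)" for n by (simp add: u_def)
  obtain \<rho> E2 where E2: "\<And>n. E2 n \<in> events" "(\<lambda>n. prob (E2 n)) \<longlonglongrightarrow> 0" and \<rho>: "\<rho> \<longlonglongrightarrow> 0" and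
    ev2: "eventually (\<lambda>n. 0 < \<rho> n \<and> 0 \<le> L n \<and>
      unit_ball_vol ?d * \<rho> n ^ DIM('a) = (measure lborel S - C * e n) * L n / real n \<and>
      (\<forall>\<omega>\<in>space M - E2 n. \<forall>x. cball x (\<rho> n) \<subseteq> S \<longrightarrow> sample n \<omega> \<inter> cball x (\<rho> n) \<noteq> {})) sequentially"
    by (rule balls_hit_eventually[OF e_ln u_top u_le L_def, of C]) (rule that)
  have "\<forall>n. \<exists>E. E \<in> events \<and> prob E = 0 \<and> (\<forall>\<omega>\<in>space M - E. sample n \<omega> \<subseteq> S)"
    using sample_subset_ae by metis
  then obtain E3 where E3: "\<And>n. E3 n \<in> events" "\<And>n. prob (E3 n) = 0" "\<And>n \<omega>. \<omega> \<in> space M - E3 n \<Longrightarrow> sample n \<omega> \<subseteq> S"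
    by metis
  define V where "V = measure lborel (convex hull S)"
  have L'n: "(\<lambda>n. V * L' n / real n) \<longlonglongrightarrow> 0"
  proof -
    have 1: "(\<lambda>n. (ln (real n) + (?d - 1) * ln (ln (real n)) + b) / real n) \<longlonglongrightarrow> 0" by real_asymp
    have "(\<lambda>n. V * (gumbel_quantile (a n) / real n + (ln (real n) + (?d - 1) * ln (ln (real n)) + b) / real n)) \<longlonglongrightarrow> V * (0 + 0)"
      by (intro tendsto_intros 1 gumbel_quantile_over_n a)
    thus ?thesis by (simp add: L'_def add_divide_distrib[symmetric] add.assoc)
  qed
  define E where "E n = E1 n \<union> E2 n \<union> E3 n" for n
  have Ee: "E n \<in> events" for n using E1(1) E2(1) E3(1) by (simp add: E_def)
  have prob0: "(\<lambda>n. prob (E n)) \<longlonglongrightarrow> 0"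
  proof (rule tendsto_sandwich[OF _ _ tendsto_const])
    show "eventually (\<lambda>n. prob (E n) \<le> prob (E1 n) + prob (E2 n)) sequentially"
    proof (intro always_eventually allI)
      fix n
      have "prob (E n) \<le> prob (E1 n \<union> E2 n) + prob (E3 n)"
        unfolding E_def using E1(1) E2(1) E3(1) by (intro measure_Un_le) auto
      also have "prob (E1 n \<union> E2 n) \<le> prob (E1 n) + prob (E2 n)" using E1(1) E2(1) by (intro measure_Un_le) auto
      finally show "prob (E n) \<le> prob (E1 n) + prob (E2 n)" using E3(2) by simp
    qed
    show "(\<lambda>n. prob (E1 n) + prob (E2 n)) \<longlonglongrightarrow> 0" using tendsto_add[OF E1(2) E2(2)] by simp
  qed simp
  \<comment> \<open>The factor \<open>2\<close> comes from the frontiers, \<open>C\<close> from the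
    volume of the shell.\<close>
  define K' where "K' = max 2 C * K"
  have ev_\<rho>: "eventually (\<lambda>n. \<rho> n < min l (k / 2)) sequentially"
    using \<rho> l_pos k by (intro order_tendstoD(2)) auto
  have ev_e: "eventually (\<lambda>n. e n < l) sequentially" using e0 l_pos by (intro order_tendstoD(2)) auto
  have ev_V: "eventually (\<lambda>n. V * L' n / real n < unit_ball_vol ?d * k ^ DIM('a)) sequentially"
    using L'n k by (intro order_tendstoD(2)) auto
  have "eventually (\<lambda>n. \<forall>\<omega>\<in>space M - E n. \<bar>hausdorff_distance S (H n \<omega>)\<bar> \<le> K' * rate n \<and>
       \<bar>hausdorff_distance (frontier S) (frontier (H n \<omega>))\<bar> \<le> K' * rate n \<and>
       \<bar>measure_distance S (H n \<omega>)\<bar> \<le> K' * rate n) sequentially"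
    using E1(3) ev2 ev_\<rho> ev_e ev_V eventually_ge_at_top[of 2]
  proof eventually_elim
    case (elim n)
    have n: "2 \<le> n" and \<rho>n: "0 < \<rho> n" "\<rho> n \<le> l" "2 * \<rho> n < k" and en: "e n \<le> l" and Ln: "0 \<le> L n" "0 \<le> L' n"
      using elim LL'[of n] by auto
    have ratep: "0 < rate n" unfolding rate_def using n by simp
    hence e: "0 < e n" using K by (simp add: e_def)
    show ?case
    proof
      fix \<omega> assume \<omega>: "\<omega> \<in> space M - E n"
      let ?A = "sample n \<omega>"
      have AS: "?A \<subseteq> S" using E3(3) \<omega> by (auto simp: E_def)
      have Ane: "?A \<noteq> {}" using n by (simp add: sample_def)
      have er: "erosion (e n) S \<subseteq> r_convex_hull (\<nu> * g) ?A" using elim(1) \<omega> by (auto simp: E_def e_def)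
      have hit: "\<And>x. cball x (\<rho> n) \<subseteq> S \<Longrightarrow> ?A \<inter> cball x (\<rho> n) \<noteq> {}"
        using elim(2) \<omega> by (auto simp: E_def)
      have er_g: "erosion (e n) S \<subseteq> r_convex_hull g ?A" using er r_convex_hull_mono_radius[OF \<nu>g] by blast
      have vol: "unit_ball_vol ?d * \<rho> n ^ DIM('a) \<le> (measure lborel S - C * e n) * L n / real n"
        using elim(2) by simp
      have low: "ennreal g \<le> r0_estimator n (a n) ?A"
        by (rule r0_estimator_lower[OF AS g(1,2) er_g C(2)[OF e] hit less_imp_le[OF \<rho>n(1)] vol Ln(1)])
          (use LL'[of n] in \<open>simp_all add: L'_def b_def\<close>)
      have dense: "\<exists>a\<in>?A. dist s a < k" if s: "s \<in> S" for s
      proof -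
        obtain a where "a \<in> ?A" "dist s a \<le> 2 * \<rho> n"
          using dense_if_meets_balls[OF \<rho>n(1,2) hit s] by blast
        thus ?thesis using \<rho>n by force
      qed
      have up: "r0_estimator n (a n) ?A \<le> ennreal m"
        by (rule r0_estimator_upper[OF finite_sample Ane AS m(3) k(1) k(2)[OF AS dense] Ln(2)])
          (use elim(5) in \<open>simp_all add: L'_def b_def V_def\<close>)
      let ?rn = "ennreal \<nu> * r0_estimator n (a n) ?A"
      have rn1: "ennreal (\<nu> * g) \<le> ?rn" using mult_left_mono[OF low, of "ennreal \<nu>"] \<nu> g by (simp add: ennreal_mult)
      have rn2: "?rn \<le> ennreal (\<nu> * m)" using mult_left_mono[OF up, of "ennreal \<nu>"] \<nu> m by (simp add: ennreal_mult)
      have self: "r_convex_hull (\<nu> * m) S = S" using r0(2) m \<nu> by simp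
      have "e n \<le> K' * rate n" "2 * e n \<le> K' * rate n" "C * e n \<le> K' * rate n"
        using K ratep by (auto simp: e_def K'_def mult.assoc intro!: mult_right_mono)
      moreover note hull_distances[OF AS e en er \<nu>g(1) rn1 rn2 self] C(2)[OF e]
      ultimately show "\<bar>hausdorff_distance S (H n \<omega>)\<bar> \<le> K' * rate n \<and>
         \<bar>hausdorff_distance (frontier S) (frontier (H n \<omega>))\<bar> \<le> K' * rate n \<and>
         \<bar>measure_distance S (H n \<omega>)\<bar> \<le> K' * rate n"
        unfolding H_def by linarith
    qed
  qed
  with Ee prob0 show ?thesis by (rule that)
qed

end

text \<open>One \<open>K\<close> works for every \<epsilon>, since the probabilities of the
  exceptional events tend to zero. These events are the measurable supersets required by
  \<open>bigO_P\<close>.\<close>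

lemma (in prob_space) bigO_P_I:
  assumes E: "\<And>n. E n \<in> events" "(\<lambda>n. prob (E n)) \<longlonglongrightarrow> 0"
    and Y: "eventually (\<lambda>n. \<forall>\<omega>\<in>space M - E n. \<bar>Y n \<omega>\<bar> \<le> K * \<bar>y n\<bar>) sequentially"
  shows "bigO_P M Y y"
  unfolding bigO_P_def
proof (intro allI impI)
  fix \<epsilon> :: real assume "0 < \<epsilon>"
  with E(2) have "eventually (\<lambda>n. prob (E n) < \<epsilon>) sequentially" by (rule order_tendstoD)
  with Y have "eventually (\<lambda>n. {\<omega> \<in> space M. K * \<bar>y n\<bar> < \<bar>Y n \<omega>\<bar>} \<subseteq> E n \<and> prob (E n) \<le> \<epsilon>) sequentially"
  proof eventually_elim
    case (elim n)
    hence "\<omega> \<in> E n" if "\<omega> \<in> space M" "K * \<bar>y n\<bar> < \<bar>Y n \<omega>\<bar>" for \<omega>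
      using that by (meson DiffI not_le)
    thus ?case using elim(2) by auto
  qed
  then obtain N where "\<forall>n\<ge>N. {\<omega> \<in> space M. K * \<bar>y n\<bar> < \<bar>Y n \<omega>\<bar>} \<subseteq> E n \<and> prob (E n) \<le> \<epsilon>"
    by (auto simp: eventually_sequentially)
  thus "\<exists>K N. \<forall>n\<ge>N. \<exists>E\<in>events. {\<omega> \<in> space M. K * \<bar>y n\<bar> < \<bar>Y n \<omega>\<bar>} \<subseteq> E \<and> prob E \<le> \<epsilon>"
    using E(1) by meson
qed

theorem theorem4p3:
  fixes S :: "'a::euclidean_space set"
    and M :: "'b measure"
    and X :: "nat \<Rightarrow> 'b \<Rightarrow> 'a"
    and \<alpha> :: "nat \<Rightarrow> real"
    and \<nu> r l :: real
    and Xn :: "nat \<Rightarrow> 'b \<Rightarrow> 'a set"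
    and Cn :: "nat \<Rightarrow> 'b \<Rightarrow> 'a set"
    and rn :: "nat \<Rightarrow> 'b \<Rightarrow> ennreal"
    and rate :: "nat \<Rightarrow> real"
  assumes "compact S" and "\<not> convex S" and "S \<noteq> {}"
    and "r > 0" and "l > 0" and "rolling_R l r S"
    and "prob_space M"
    and "prob_space.indep_vars M (\<lambda>_. borel) X {1..}"
    and "\<And>i. i \<ge> 1 \<Longrightarrow> distr M borel (X i) = uniform_measure lborel S"
    and "\<And>n. n \<ge> 1 \<Longrightarrow> 0 < \<alpha> n \<and> \<alpha> n < 1"
    and "\<alpha> \<longlonglongrightarrow> 0"
    and "(\<lambda>n. ln (\<alpha> n) / real n) \<longlonglongrightarrow> 0"
    and "0 < \<nu>" and "\<nu> < 1"
  defines "Xn \<equiv> \<lambda>n \<omega>. (\<lambda>i. X i \<omega>) ` {1..n}"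
    and "rn \<equiv> \<lambda>n \<omega>. ennreal \<nu> * r0_estimator n (\<alpha> n) (Xn n \<omega>)"
    and "Cn \<equiv> \<lambda>n \<omega>. r_convex_hull_ext (rn n \<omega>) (Xn n \<omega>)"
    and "rate \<equiv> \<lambda>n. (ln (real n) / real n) powr (2 / (real DIM('a) + 1))"
  shows "bigO_P M (\<lambda>n \<omega>. hausdorff_distance S (Cn n \<omega>)) rate
       \<and> bigO_P M (\<lambda>n \<omega>. hausdorff_distance (frontier S) (frontier (Cn n \<omega>))) rate
       \<and> bigO_P M (\<lambda>n \<omega>. measure_distance S (Cn n \<omega>)) rate"
proof -
  interpret uniform_sample S r l M X
    using assms(1,3-9) by (simp add: uniform_sample_def rolling_set_def uniform_sample_axioms_def)
  have Cn: "Cn n \<omega> = r_convex_hull_ext (ennreal \<nu> * r0_estimator n (\<alpha> n) (sample n \<omega>)) (sample n \<omega>)" for n \<omega>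
    by (simp add: Cn_def rn_def Xn_def sample_def)
  have rate: "\<bar>rate n\<bar> = rate n" for n by (simp add: rate_def)
  obtain K E where E: "\<And>n. E n \<in> events" "(\<lambda>n. prob (E n)) \<longlonglongrightarrow> 0" and
    ev: "eventually (\<lambda>n. \<forall>\<omega>\<in>space M - E n. \<bar>hausdorff_distance S (Cn n \<omega>)\<bar> \<le> K * rate n \<and>
       \<bar>hausdorff_distance (frontier S) (frontier (Cn n \<omega>))\<bar> \<le> K * rate n \<and>
       \<bar>measure_distance S (Cn n \<omega>)\<bar> \<le> K * rate n) sequentially"
    unfolding Cn rate_def using sample_hull_distances[OF assms(2,11,10,12-14)] by blast
  show ?thesis
    by (intro conjI bigO_P_I[where K = K, OF E]) (use ev in \<open>auto simp: rate elim!: eventually_mono\<close>)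
qed

end
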